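(* Let $Q$ be an acyclic finite quiver, $k$ a field, $M$ a finite-dimensional $kQ$-module of dimension vector $\underline{m}$, and $U$ a submodule of $M$ of dimension vector $\underline{e}$. Then the tangent space $T_U(\operatorname{Gr}_{\underline{e}}(M))$ at $U$ of the quiver Grassmannian $\operatorname{Gr}_{\underline{e}}(M)$, considered as a scheme, is isomorphic to $\operatorname{Hom}_{kQ}(U,M/U)$.
   Context: Acyclic means without oriented cycles; $kQ$ is the path algebra and $kQ$-modules are identified with representations of $Q$. $\operatorname{Gr}_{\underline{e}}(M)$ is the quiver Grassmannian, considered as a scheme over $k$: the closed subscheme of $\prod_{i\in Q_0}\operatorname{Gr}(e_i,M_i)$ of tuples of subspaces $(U_i)_i$ with $M_h(U_{s(h)})\subset U_{t(h)}$ for all arrows $h$ (source $s(h)$, target $t(h)$); it parametrizes submodules of $M$ of dimension vector $\underline{e}$. *)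

theory Defs
  imports
    "HOL-Algebra.QuotRing"
    "HOL-Algebra.Ideal_Product"
    "HOL-Algebra.Module"
    "HOL-Library.Poly_Mapping"
    "Graph_Theory.Arc_Walk"
begin

section \<open>Vector spaces with explicit carrier\<close>

text \<open>A vector space over \<open>'k\<close> is a record of type \<open>('k, 'w) module\<close>. Only the fields
  carrier, zero, add and smult matter; mult and one are inherited from the ring record and left
  unspecified. Linear maps are extensional, so that equality of maps is equality on the carrier.\<close>

definition vec_space ::
  "'w set \<Rightarrow> 'w \<Rightarrow> ('w \<Rightarrow> 'w \<Rightarrow> 'w) \<Rightarrow> ('k \<Rightarrow> 'w \<Rightarrow> 'w) \<Rightarrow> ('k, 'w) module" where
  "vec_space C z pl sm =
     \<lparr>carrier = C, mult = undefined, one = undefined, zero = z, add = pl, smult = sm\<rparr>"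

definition lin_maps :: "('k, 'w) module \<Rightarrow> ('k, 'x) module \<Rightarrow> ('w \<Rightarrow> 'x) set" where
  "lin_maps V W = {\<phi> \<in> carrier V \<rightarrow>\<^sub>E carrier W.
     (\<forall>x\<in>carrier V. \<forall>y\<in>carrier V. \<phi> (x \<oplus>\<^bsub>V\<^esub> y) = \<phi> x \<oplus>\<^bsub>W\<^esub> \<phi> y) \<and>
     (\<forall>c. \<forall>x\<in>carrier V. \<phi> (c \<odot>\<^bsub>V\<^esub> x) = c \<odot>\<^bsub>W\<^esub> \<phi> x)}"

definition lin_iso :: "('k, 'w) module \<Rightarrow> ('k, 'x) module \<Rightarrow> bool" where
  "lin_iso V W \<longleftrightarrow> (\<exists>\<phi>\<in>lin_maps V W. bij_betw \<phi> (carrier V) (carrier W))"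

definition base_space :: "('k::field, 'k) module" where
  "base_space = vec_space UNIV 0 (+) (*)"

definition dual_space :: "('k::field, 'w) module \<Rightarrow> ('k, 'w \<Rightarrow> 'k) module" where
  "dual_space V = vec_space (lin_maps V base_space)
     (\<lambda>x\<in>carrier V. 0)
     (\<lambda>\<phi> \<psi>. \<lambda>x\<in>carrier V. \<phi> x + \<psi> x)
     (\<lambda>c \<phi>. \<lambda>x\<in>carrier V. c * \<phi> x)"

definition subspace_space ::
  "('k \<Rightarrow> 'b \<Rightarrow> 'b) \<Rightarrow> 'b::ab_group_add set \<Rightarrow> ('k, 'b) module" where
  "subspace_space scale S = vec_space S 0 (+) scale"

definition quot_space :: "('k, 'w) module \<Rightarrow> 'w set \<Rightarrow> ('k, 'w set) module" where
  "quot_space V N = vec_space (a_rcosets\<^bsub>V\<^esub> N) N (set_add V)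
     (\<lambda>c A. \<Union>x\<in>A. N +>\<^bsub>V\<^esub> (c \<odot>\<^bsub>V\<^esub> x))"


section \<open>Representations of a quiver\<close>

record ('v, 'a, 'k, 'w) quiver_rep =
  rep_space :: "'v \<Rightarrow> ('k, 'w) module"
  rep_map :: "'a \<Rightarrow> 'w \<Rightarrow> 'w"

definition rep_hom :: "('v, 'a) pre_digraph \<Rightarrow> ('v, 'a, 'k, 'w) quiver_rep \<Rightarrow>
    ('v, 'a, 'k, 'x) quiver_rep \<Rightarrow> ('k, 'v \<Rightarrow> 'w \<Rightarrow> 'x) module" where
  "rep_hom Q V W = vec_space
     {\<phi> \<in> (\<Pi>\<^sub>E i\<in>verts Q. lin_maps (rep_space V i) (rep_space W i)).
        \<forall>h\<in>arcs Q. \<forall>x\<in>carrier (rep_space V (tail Q h)).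
          \<phi> (head Q h) (rep_map V h x) = rep_map W h (\<phi> (tail Q h) x)}
     (\<lambda>i\<in>verts Q. \<lambda>x\<in>carrier (rep_space V i). \<zero>\<^bsub>rep_space W i\<^esub>)
     (\<lambda>\<phi> \<psi>. \<lambda>i\<in>verts Q. \<lambda>x\<in>carrier (rep_space V i). \<phi> i x \<oplus>\<^bsub>rep_space W i\<^esub> \<psi> i x)
     (\<lambda>c \<phi>. \<lambda>i\<in>verts Q. \<lambda>x\<in>carrier (rep_space V i). c \<odot>\<^bsub>rep_space W i\<^esub> \<phi> i x)"

text \<open>A representation is given by subspaces \<open>M i\<close> of one ambient vector space (for a
  \<open>kQ\<close>-module this is the module itself) and maps \<open>f h\<close> that are only relevant
  on \<open>M (tail Q h)\<close>.\<close>

definition is_fd_rep :: "('k::field \<Rightarrow> 'b \<Rightarrow> 'b) \<Rightarrow> ('v, 'a) pre_digraph \<Rightarrow>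
    ('v \<Rightarrow> 'b::ab_group_add set) \<Rightarrow> ('a \<Rightarrow> 'b \<Rightarrow> 'b) \<Rightarrow> bool" where
  "is_fd_rep scale Q M f \<longleftrightarrow>
     (\<forall>i\<in>verts Q. module.subspace scale (M i) \<and> (\<exists>S. finite S \<and> M i = module.span scale S)) \<and>
     (\<forall>h\<in>arcs Q. f h \<in> M (tail Q h) \<rightarrow> M (head Q h) \<and>
        (\<forall>x\<in>M (tail Q h). \<forall>y\<in>M (tail Q h). f h (x + y) = f h x + f h y) \<and>
        (\<forall>c. \<forall>x\<in>M (tail Q h). f h (scale c x) = scale c (f h x)))"

definition is_subrep :: "('k::field \<Rightarrow> 'b \<Rightarrow> 'b) \<Rightarrow> ('v, 'a) pre_digraph \<Rightarrow>
    ('v \<Rightarrow> 'b::ab_group_add set) \<Rightarrow> ('a \<Rightarrow> 'b \<Rightarrow> 'b) \<Rightarrow> ('v \<Rightarrow> 'b set) \<Rightarrow> bool" where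
  "is_subrep scale Q M f U \<longleftrightarrow>
     (\<forall>i\<in>verts Q. module.subspace scale (U i) \<and> U i \<subseteq> M i) \<and>
     (\<forall>h\<in>arcs Q. f h ` U (tail Q h) \<subseteq> U (head Q h))"

definition has_dim_vector :: "('k::field \<Rightarrow> 'b \<Rightarrow> 'b) \<Rightarrow> ('v, 'a) pre_digraph \<Rightarrow>
    ('v \<Rightarrow> 'b::ab_group_add set) \<Rightarrow> ('v \<Rightarrow> nat) \<Rightarrow> bool" where
  "has_dim_vector scale Q M m \<longleftrightarrow> (\<forall>i\<in>verts Q. vector_space.dim scale (M i) = m i)"

definition rep_of :: "('k::field \<Rightarrow> 'b \<Rightarrow> 'b) \<Rightarrow> ('v \<Rightarrow> 'b::ab_group_add set) \<Rightarrow>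
    ('a \<Rightarrow> 'b \<Rightarrow> 'b) \<Rightarrow> ('v, 'a, 'k, 'b) quiver_rep" where
  "rep_of scale M f = \<lparr>rep_space = (\<lambda>i. subspace_space scale (M i)), rep_map = f\<rparr>"

definition quot_rep :: "('v, 'a) pre_digraph \<Rightarrow> ('v, 'a, 'k, 'w) quiver_rep \<Rightarrow>
    ('v \<Rightarrow> 'w set) \<Rightarrow> ('v, 'a, 'k, 'w set) quiver_rep" where
  "quot_rep Q V U = \<lparr>rep_space = (\<lambda>i. quot_space (rep_space V i) (U i)),
     rep_map = (\<lambda>h A. \<Union>x\<in>A. U (head Q h) +>\<^bsub>rep_space V (head Q h)\<^esub> rep_map V h x)\<rparr>"


section \<open>Localization and the Zariski tangent space\<close>

definition loc_frac :: "('r, 'z) ring_scheme \<Rightarrow> 'r set \<Rightarrow> 'r \<Rightarrow> 'r \<Rightarrow> ('r \<times> 'r) set" where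
  "loc_frac R S r s = {(r', s'). r' \<in> carrier R \<and> s' \<in> S \<and>
     (\<exists>t\<in>S. t \<otimes>\<^bsub>R\<^esub> (r \<otimes>\<^bsub>R\<^esub> s' \<ominus>\<^bsub>R\<^esub> r' \<otimes>\<^bsub>R\<^esub> s) = \<zero>\<^bsub>R\<^esub>)}"

definition localization :: "('r, 'z) ring_scheme \<Rightarrow> 'r set \<Rightarrow> ('r \<times> 'r) set ring" where
  "localization R S = \<lparr>
     carrier = {loc_frac R S r s |r s. r \<in> carrier R \<and> s \<in> S},
     mult = (\<lambda>X Y. \<Union>(r, s)\<in>X. \<Union>(r', s')\<in>Y. loc_frac R S (r \<otimes>\<^bsub>R\<^esub> r') (s \<otimes>\<^bsub>R\<^esub> s')),
     one = loc_frac R S \<one>\<^bsub>R\<^esub> \<one>\<^bsub>R\<^esub>,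
     zero = loc_frac R S \<zero>\<^bsub>R\<^esub> \<one>\<^bsub>R\<^esub>,
     add = (\<lambda>X Y. \<Union>(r, s)\<in>X. \<Union>(r', s')\<in>Y.
       loc_frac R S (r \<otimes>\<^bsub>R\<^esub> s' \<oplus>\<^bsub>R\<^esub> r' \<otimes>\<^bsub>R\<^esub> s) (s \<otimes>\<^bsub>R\<^esub> s'))\<rparr>"

definition local_ring :: "('r, 'z) ring_scheme \<Rightarrow> 'r set \<Rightarrow> ('r \<times> 'r) set ring" where
  "local_ring R P = localization R (carrier R - P)"

definition local_max_ideal :: "('r, 'z) ring_scheme \<Rightarrow> 'r set \<Rightarrow> ('r \<times> 'r) set set" where
  "local_max_ideal R P = {loc_frac R (carrier R - P) r s |r s. r \<in> P \<and> s \<in> carrier R - P}"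

text \<open>The space \<open>\<mm>/\<mm>\<^sup>2\<close>, as a subset of \<open>L/\<mm>\<^sup>2\<close>, for a local ring \<open>L\<close> with maximal ideal
  \<open>\<mm>\<close> and structure map \<open>\<iota>\<close> from \<open>k\<close> to \<open>L\<close>.\<close>

definition cotangent_space ::
  "('k::field \<Rightarrow> 'l) \<Rightarrow> ('l, 'z) ring_scheme \<Rightarrow> 'l set \<Rightarrow> ('k, 'l set) module" where
  "cotangent_space \<iota> L mm = (let mm2 = mm \<cdot>\<^bsub>L\<^esub> mm; D = L Quot mm2 in
     vec_space ((\<lambda>x. mm2 +>\<^bsub>L\<^esub> x) ` mm) \<zero>\<^bsub>D\<^esub> (\<lambda>x y. x \<oplus>\<^bsub>D\<^esub> y)
       (\<lambda>c x. (mm2 +>\<^bsub>L\<^esub> \<iota> c) \<otimes>\<^bsub>D\<^esub> x))"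

text \<open>The tangent space of \<open>Spec A\<close> at a \<open>k\<close>-rational point \<open>P\<close>, for a \<open>k\<close>-algebra \<open>A\<close> with
  structure map \<open>\<iota>\<close>. As the residue field at \<open>P\<close> is \<open>k\<close>, the dual of \<open>\<mm>/\<mm>\<^sup>2\<close> is taken
  over \<open>k\<close>.\<close>

definition zariski_tangent_space :: "('k::field \<Rightarrow> 'r) \<Rightarrow> ('r, 'z) ring_scheme \<Rightarrow> 'r set \<Rightarrow>
    ('k, ('r \<times> 'r) set set \<Rightarrow> 'k) module" where
  "zariski_tangent_space \<iota> A P = dual_space (cotangent_space
     (\<lambda>c. loc_frac A (carrier A - P) (\<iota> c) \<one>\<^bsub>A\<^esub>) (local_ring A P) (local_max_ideal A P))"


section \<open>Polynomial rings\<close>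

type_synonym ('x, 'k) mpoly = "('x \<Rightarrow>\<^sub>0 nat) \<Rightarrow>\<^sub>0 'k"

definition mp_const :: "'k::comm_ring_1 \<Rightarrow> ('x, 'k) mpoly" where
  "mp_const c = Poly_Mapping.single 0 c"

definition mp_var :: "'x \<Rightarrow> ('x, 'k::comm_ring_1) mpoly" where
  "mp_var x = Poly_Mapping.single (Poly_Mapping.single x 1) 1"

definition mp_eval :: "('x \<Rightarrow> 'k) \<Rightarrow> ('x, 'k::comm_ring_1) mpoly \<Rightarrow> 'k" where
  "mp_eval a p = (\<Sum>\<mu>\<in>Poly_Mapping.keys p. Poly_Mapping.lookup p \<mu> *
     (\<Prod>x\<in>Poly_Mapping.keys \<mu>. a x ^ Poly_Mapping.lookup \<mu> x))"

definition mp_ring :: "'x set \<Rightarrow> ('x, 'k::comm_ring_1) mpoly ring" where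
  "mp_ring X = \<lparr>carrier = {p. \<forall>\<mu>\<in>Poly_Mapping.keys p. Poly_Mapping.keys \<mu> \<subseteq> X},
     mult = (*), one = 1, zero = 0, add = (+)\<rparr>"


section \<open>The quiver Grassmannian\<close>

text \<open>The Grassmannian \<open>Gr(d, V)\<close> is glued from the affine spaces attached to a basis \<open>B\<close> of
  \<open>V\<close> and a subset \<open>I\<close> of \<open>B\<close> with \<open>d\<close> elements: the point with coordinates
  \<open>x r l\<close> (\<open>r \<in> B - I\<close>, \<open>l \<in> I\<close>) is the subspace spanned by the vectors
  \<open>l + (\<Sum>r\<in>B - I. x r l *s r)\<close> for \<open>l \<in> I\<close>. Charts from different bases
  are all admitted. The product of the Grassmannians is covered by the products of
  such charts, whose coordinates are indexed by triples \<open>(i, r, l)\<close>.\<close>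

definition is_chart :: "('k::field \<Rightarrow> 'b \<Rightarrow> 'b) \<Rightarrow> ('v, 'a) pre_digraph \<Rightarrow>
    ('v \<Rightarrow> 'b::ab_group_add set) \<Rightarrow> ('v \<Rightarrow> nat) \<Rightarrow> ('v \<Rightarrow> 'b set) \<Rightarrow> ('v \<Rightarrow> 'b set) \<Rightarrow> bool" where
  "is_chart scale Q M e B I \<longleftrightarrow> (\<forall>i\<in>verts Q.
     \<not> module.dependent scale (B i) \<and> module.span scale (B i) = M i \<and>
     I i \<subseteq> B i \<and> card (I i) = e i)"

definition chart_coords :: "('v, 'a) pre_digraph \<Rightarrow> ('v \<Rightarrow> 'b set) \<Rightarrow> ('v \<Rightarrow> 'b set) \<Rightarrow>
    ('v \<times> 'b \<times> 'b) set" where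
  "chart_coords Q B I = {(i, r, l). i \<in> verts Q \<and> r \<in> B i - I i \<and> l \<in> I i}"

definition chart_point :: "('k::field \<Rightarrow> 'b \<Rightarrow> 'b) \<Rightarrow> ('v \<Rightarrow> 'b::ab_group_add set) \<Rightarrow>
    ('v \<Rightarrow> 'b set) \<Rightarrow> ('v \<times> 'b \<times> 'b \<Rightarrow> 'k) \<Rightarrow> 'v \<Rightarrow> 'b set" where
  "chart_point scale B I a i =
     module.span scale ((\<lambda>l. l + (\<Sum>r\<in>B i - I i. scale (a (i, r, l)) r)) ` I i)"

text \<open>The coefficient at \<open>b \<in> B (head Q h)\<close> of the image under \<open>f h\<close> of the universal vector
  \<open>l + (\<Sum>r. x\<^sub>r\<^sub>l *s r)\<close> at the vertex \<open>tail Q h\<close>.\<close>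

definition image_coeff :: "('k::field \<Rightarrow> 'b \<Rightarrow> 'b) \<Rightarrow> ('v, 'a) pre_digraph \<Rightarrow>
    ('a \<Rightarrow> 'b \<Rightarrow> 'b) \<Rightarrow> ('v \<Rightarrow> 'b::ab_group_add set) \<Rightarrow> ('v \<Rightarrow> 'b set) \<Rightarrow>
    'a \<Rightarrow> 'b \<Rightarrow> 'b \<Rightarrow> ('v \<times> 'b \<times> 'b, 'k) mpoly" where
  "image_coeff scale Q f B I h l b =
     mp_const (module.representation scale (B (head Q h)) (f h l) b) +
     (\<Sum>r\<in>B (tail Q h) - I (tail Q h). mp_var (tail Q h, r, l) *
        mp_const (module.representation scale (B (head Q h)) (f h r) b))"

text \<open>On a chart the projection from \<open>V\<close> onto the universal quotient has the coordinates
  \<open>y \<mapsto> y\<^sub>r - (\<Sum>l'\<in>I. x\<^sub>r\<^sub>l\<^sub>' * y\<^sub>l\<^sub>')\<close> for \<open>r \<in> B - I\<close>. The closed subscheme where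
  \<open>f h\<close> maps the universal subspace at \<open>tail Q h\<close> into the one at \<open>head Q h\<close>
  is the zero scheme of the composite map from the universal subspace at the tail to the
  universal quotient at the head, that is, of the following polynomials.\<close>

definition incidence_poly :: "('k::field \<Rightarrow> 'b \<Rightarrow> 'b) \<Rightarrow> ('v, 'a) pre_digraph \<Rightarrow>
    ('a \<Rightarrow> 'b \<Rightarrow> 'b) \<Rightarrow> ('v \<Rightarrow> 'b::ab_group_add set) \<Rightarrow> ('v \<Rightarrow> 'b set) \<Rightarrow>
    'a \<Rightarrow> 'b \<Rightarrow> 'b \<Rightarrow> ('v \<times> 'b \<times> 'b, 'k) mpoly" where
  "incidence_poly scale Q f B I h l r =
     image_coeff scale Q f B I h l r -
     (\<Sum>l'\<in>I (head Q h). mp_var (head Q h, r, l') * image_coeff scale Q f B I h l l')"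

definition incidence_ideal :: "('k::field \<Rightarrow> 'b \<Rightarrow> 'b) \<Rightarrow> ('v, 'a) pre_digraph \<Rightarrow>
    ('a \<Rightarrow> 'b \<Rightarrow> 'b) \<Rightarrow> ('v \<Rightarrow> 'b::ab_group_add set) \<Rightarrow> ('v \<Rightarrow> 'b set) \<Rightarrow>
    ('v \<times> 'b \<times> 'b, 'k) mpoly set" where
  "incidence_ideal scale Q f B I = genideal (mp_ring (chart_coords Q B I))
     {incidence_poly scale Q f B I h l r |h l r.
        h \<in> arcs Q \<and> l \<in> I (tail Q h) \<and> r \<in> B (head Q h) - I (head Q h)}"

text \<open>Coordinate ring of the intersection of the quiver Grassmannian with a chart, its
  structure map from \<open>k\<close>, and the prime ideal of the \<open>k\<close>-point with coordinates \<open>a\<close>.\<close>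

definition chart_ring :: "('k::field \<Rightarrow> 'b \<Rightarrow> 'b) \<Rightarrow> ('v, 'a) pre_digraph \<Rightarrow>
    ('a \<Rightarrow> 'b \<Rightarrow> 'b) \<Rightarrow> ('v \<Rightarrow> 'b::ab_group_add set) \<Rightarrow> ('v \<Rightarrow> 'b set) \<Rightarrow>
    ('v \<times> 'b \<times> 'b, 'k) mpoly set ring" where
  "chart_ring scale Q f B I = mp_ring (chart_coords Q B I) Quot incidence_ideal scale Q f B I"

definition chart_ring_const :: "('k::field \<Rightarrow> 'b \<Rightarrow> 'b) \<Rightarrow> ('v, 'a) pre_digraph \<Rightarrow>
    ('a \<Rightarrow> 'b \<Rightarrow> 'b) \<Rightarrow> ('v \<Rightarrow> 'b::ab_group_add set) \<Rightarrow> ('v \<Rightarrow> 'b set) \<Rightarrow>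
    'k \<Rightarrow> ('v \<times> 'b \<times> 'b, 'k) mpoly set" where
  "chart_ring_const scale Q f B I c =
     incidence_ideal scale Q f B I +>\<^bsub>mp_ring (chart_coords Q B I)\<^esub> mp_const c"

definition chart_ring_point :: "('k::field \<Rightarrow> 'b \<Rightarrow> 'b) \<Rightarrow> ('v, 'a) pre_digraph \<Rightarrow>
    ('a \<Rightarrow> 'b \<Rightarrow> 'b) \<Rightarrow> ('v \<Rightarrow> 'b::ab_group_add set) \<Rightarrow> ('v \<Rightarrow> 'b set) \<Rightarrow>
    ('v \<times> 'b \<times> 'b \<Rightarrow> 'k) \<Rightarrow> ('v \<times> 'b \<times> 'b, 'k) mpoly set set" where
  "chart_ring_point scale Q f B I a =
     {incidence_ideal scale Q f B I +>\<^bsub>mp_ring (chart_coords Q B I)\<^esub> p |p.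
        p \<in> carrier (mp_ring (chart_coords Q B I)) \<and> mp_eval a p = 0}"

definition chart_at :: "('k::field \<Rightarrow> 'b \<Rightarrow> 'b) \<Rightarrow> ('v, 'a) pre_digraph \<Rightarrow>
    ('v \<Rightarrow> 'b::ab_group_add set) \<Rightarrow> ('v \<Rightarrow> nat) \<Rightarrow> ('v \<Rightarrow> 'b set) \<Rightarrow>
    ('v \<Rightarrow> 'b set) \<Rightarrow> ('v \<Rightarrow> 'b set) \<Rightarrow> ('v \<times> 'b \<times> 'b \<Rightarrow> 'k) \<Rightarrow> bool" where
  "chart_at scale Q M e U B I a \<longleftrightarrow> is_chart scale Q M e B I \<and>
     (\<forall>i\<in>verts Q. U i = chart_point scale B I a i)"

text \<open>Tangent space of the quiver Grassmannian at the point with coordinates \<open>a\<close> in the chart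
  given by \<open>B\<close> and \<open>I\<close>.\<close>

definition quiver_grass_tangent :: "('k::field \<Rightarrow> 'b \<Rightarrow> 'b) \<Rightarrow> ('v, 'a) pre_digraph \<Rightarrow>
    ('a \<Rightarrow> 'b \<Rightarrow> 'b) \<Rightarrow> ('v \<Rightarrow> 'b::ab_group_add set) \<Rightarrow> ('v \<Rightarrow> 'b set) \<Rightarrow>
    ('v \<times> 'b \<times> 'b \<Rightarrow> 'k) \<Rightarrow>
    ('k, (('v \<times> 'b \<times> 'b, 'k) mpoly set \<times> ('v \<times> 'b \<times> 'b, 'k) mpoly set) set set \<Rightarrow> 'k) module"
  where
  "quiver_grass_tangent scale Q f B I a = zariski_tangent_space
     (chart_ring_const scale Q f B I) (chart_ring scale Q f B I)
     (chart_ring_point scale Q f B I a)"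

end

theory Submission
  imports Defs "HOL-Computational_Algebra.Polynomial"
begin

text \<open>At a \<open>k\<close>-rational point of an affine scheme \<open>Spec A\<close>, every fraction \<open>p/s\<close> in the maximal ideal
  \<open>\<mm>\<close> of the local ring is congruent to \<open>p/1\<close> times the scalar \<open>1/s(P)\<close> modulo \<open>\<mm>\<^sup>2\<close>, so
  linear forms on \<open>\<mm>/\<mm>\<^sup>2\<close> are the \<open>k\<close>-derivations of \<open>A\<close> at the point. If \<open>A\<close> is a quotient of
  a polynomial ring, such a derivation is a direction \<open>d\<close> in the kernel of the Jacobian of the
  equations.

  On a chart of the Grassmannian, a direction \<open>d\<close> displaces the basis vector \<open>u\<^sub>l\<close> of \<open>U\<^sub>i\<close> by
  \<open>\<Sum>r. d\<^sub>r\<^sub>l r\<close>; extended linearly this is a map \<open>w\<^sub>i\<close> from \<open>U\<^sub>i\<close> to the complement of \<open>U\<^sub>i\<close>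
  spanned by \<open>B\<^sub>i - I\<^sub>i\<close>, that is, a linear map from \<open>U\<^sub>i\<close> to \<open>M\<^sub>i/U\<^sub>i\<close>, and all linear maps arise in
  this way. The derivatives of the incidence polynomials of an arrow \<open>h\<close> are the coordinates of
  \<open>f\<^sub>h w u\<^sub>l - w f\<^sub>h u\<^sub>l\<close> in the quotient at the head, so the Jacobian kernel consists of the families
  that commute with the arrows.\<close>

section \<open>Localization\<close>

locale localizing_set = cring R for R (structure) +
  fixes S
  assumes S_subset: "S \<subseteq> carrier R" and one_S: "\<one> \<in> S"
    and mult_S: "\<lbrakk>s \<in> S; t \<in> S\<rbrakk> \<Longrightarrow> s \<otimes> t \<in> S"
begin

lemma S_carrier: "s \<in> S \<Longrightarrow> s \<in> carrier R"
  using S_subset by blast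

context
  notes S_carrier [simp, intro]
begin

lemma frac_refl:
  assumes "r \<in> carrier R" "s \<in> S"
  shows "(r, s) \<in> loc_frac R S r s"
proof -
  have "\<one> \<otimes> (r \<otimes> s \<ominus> r \<otimes> s) = \<zero>"
    using assms by (simp add: minus_eq r_neg)
  then show ?thesis using assms one_S unfolding loc_frac_def by blast
qed

lemma mem_frac_trans:
  assumes "r \<in> carrier R" "s \<in> S" "(r', s') \<in> loc_frac R S r s" "(r'', s'') \<in> loc_frac R S r' s'"
  shows "(r'', s'') \<in> loc_frac R S r s"
proof -
  obtain t t' where h: "r' \<in> carrier R" "s' \<in> S" "r'' \<in> carrier R" "s'' \<in> S" "t \<in> S" "t' \<in> S"
    and 1: "t \<otimes> (r \<otimes> s' \<ominus> r' \<otimes> s) = \<zero>" and 2: "t' \<otimes> (r' \<otimes> s'' \<ominus> r'' \<otimes> s') = \<zero>"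
    using assms unfolding loc_frac_def by blast
  have c: "r \<in> carrier R" "s \<in> carrier R" "r' \<in> carrier R" "s' \<in> carrier R" "r'' \<in> carrier R"
    "s'' \<in> carrier R" "t \<in> carrier R" "t' \<in> carrier R" using h assms by auto
  \<comment> \<open>With zero divisors present, the clearing element must also contain s':
    multiplying by it lets r s'' - r'' s be written as a combination of the two given
    differences.\<close>
  have "(t \<otimes> t' \<otimes> s') \<otimes> (r \<otimes> s'' \<ominus> r'' \<otimes> s) =
     (t' \<otimes> s'') \<otimes> (t \<otimes> (r \<otimes> s' \<ominus> r' \<otimes> s)) \<oplus> (t \<otimes> s) \<otimes> (t' \<otimes> (r' \<otimes> s'' \<ominus> r'' \<otimes> s'))"
    using c by algebra
  also have "\<dots> = \<zero>" unfolding 1 2 using c by simp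
  finally show ?thesis using h mult_S unfolding loc_frac_def by blast
qed

lemma mem_frac_sym:
  assumes "r \<in> carrier R" "s \<in> S" "(r', s') \<in> loc_frac R S r s"
  shows "(r, s) \<in> loc_frac R S r' s'"
proof -
  obtain t where h: "r' \<in> carrier R" "s' \<in> S" "t \<in> S"
    and 1: "t \<otimes> (r \<otimes> s' \<ominus> r' \<otimes> s) = \<zero>"
    using assms unfolding loc_frac_def by blast
  have c: "r \<in> carrier R" "s \<in> carrier R" "r' \<in> carrier R" "s' \<in> carrier R" "t \<in> carrier R"
    using h assms by auto
  have "t \<otimes> (r' \<otimes> s \<ominus> r \<otimes> s') = \<ominus> (t \<otimes> (r \<otimes> s' \<ominus> r' \<otimes> s))"
    using c by algebra
  then have "t \<otimes> (r' \<otimes> s \<ominus> r \<otimes> s') = \<zero>" unfolding 1 by simp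
  then show ?thesis using h assms unfolding loc_frac_def by blast
qed

text \<open>A fraction is the set of its representatives, so two fractions agree as soon as one
  contains a representative of the other. All checks that an operation is well defined go through
  this.\<close>

lemma frac_eq_mem:
  assumes "r \<in> carrier R" "s \<in> S" "(r', s') \<in> loc_frac R S r s"
  shows "loc_frac R S r' s' = loc_frac R S r s"
proof -
  have 1: "r' \<in> carrier R" "s' \<in> S" using assms(3) unfolding loc_frac_def by auto
  note 2 = mem_frac_sym[OF assms]
  show ?thesis
    using mem_frac_trans[OF 1 2] mem_frac_trans[OF assms] by (metis subrelI subset_antisym)
qed

lemma frac_eqI:
  assumes "r \<in> carrier R" "s \<in> S" "r' \<in> carrier R" "s' \<in> S" "r \<otimes> s' = r' \<otimes> s"
  shows "loc_frac R S r s = loc_frac R S r' s'"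
proof -
  have "\<one> \<otimes> (r \<otimes> s' \<ominus> r' \<otimes> s) = \<zero>"
    using assms by (simp add: minus_eq r_neg)
  then have "(r', s') \<in> loc_frac R S r s" using assms one_S unfolding loc_frac_def by blast
  then show ?thesis using frac_eq_mem assms by blast
qed

lemma frac_eqD:
  assumes "r \<in> carrier R" "s \<in> S" "r' \<in> carrier R" "s' \<in> S" "loc_frac R S r s = loc_frac R S r' s'"
  shows "\<exists>t\<in>S. t \<otimes> (r \<otimes> s' \<ominus> r' \<otimes> s) = \<zero>"
proof -
  have "(r', s') \<in> loc_frac R S r s" using frac_refl assms by simp
  then show ?thesis unfolding loc_frac_def by blast
qed

text \<open>The operations of \<open>localization\<close> are unions over all pairs of
  representatives. If every pair gives the same class C, the union over this nonempty family
  collapses to C.\<close>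

lemma loc_op:
  assumes x: "r \<in> carrier R" "s \<in> S" and y: "r' \<in> carrier R" "s' \<in> S"
    and F: "\<And>p q p' q'. (p, q) \<in> loc_frac R S r s \<Longrightarrow> (p', q') \<in> loc_frac R S r' s' \<Longrightarrow>
       F p q p' q' = C"
  shows "(\<Union>(p, q)\<in>loc_frac R S r s. \<Union>(p', q')\<in>loc_frac R S r' s'. F p q p' q') = C"
  using frac_refl[OF x] frac_refl[OF y] F by fastforce

lemma loc_mult:
  assumes x: "r \<in> carrier R" "s \<in> S" and y: "r' \<in> carrier R" "s' \<in> S"
  shows "loc_frac R S r s \<otimes>\<^bsub>localization R S\<^esub> loc_frac R S r' s' = loc_frac R S (r \<otimes> r') (s \<otimes> s')"
  unfolding localization_def monoid.simps
proof (rule loc_op[OF x y])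
  fix p q p' q' assume "(p, q) \<in> loc_frac R S r s" "(p', q') \<in> loc_frac R S r' s'"
  then obtain t t' where h: "p \<in> carrier R" "q \<in> S" "p' \<in> carrier R" "q' \<in> S" "t \<in> S" "t' \<in> S"
    and 1: "t \<otimes> (r \<otimes> q \<ominus> p \<otimes> s) = \<zero>" and 2: "t' \<otimes> (r' \<otimes> q' \<ominus> p' \<otimes> s') = \<zero>"
    unfolding loc_frac_def by blast
  have c: "r \<in> carrier R" "s \<in> carrier R" "r' \<in> carrier R" "s' \<in> carrier R" "p \<in> carrier R"
    "q \<in> carrier R" "p' \<in> carrier R" "q' \<in> carrier R" "t \<in> carrier R" "t' \<in> carrier R"
    using h x y by auto
  \<comment> \<open>The factors are exchanged one at a time: the first summand passes from r/s to
    p/q, the second from r'/s' to p'/q'.\<close>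
  have "(t \<otimes> t') \<otimes> ((r \<otimes> r') \<otimes> (q \<otimes> q') \<ominus> (p \<otimes> p') \<otimes> (s \<otimes> s')) =
     (t' \<otimes> r' \<otimes> q') \<otimes> (t \<otimes> (r \<otimes> q \<ominus> p \<otimes> s)) \<oplus> (t \<otimes> p \<otimes> s) \<otimes> (t' \<otimes> (r' \<otimes> q' \<ominus> p' \<otimes> s'))"
    using c by algebra
  also have "\<dots> = \<zero>" unfolding 1 2 using c by simp
  finally have "(p \<otimes> p', q \<otimes> q') \<in> loc_frac R S (r \<otimes> r') (s \<otimes> s')"
    using h mult_S unfolding loc_frac_def by blast
  then show "loc_frac R S (p \<otimes> p') (q \<otimes> q') = loc_frac R S (r \<otimes> r') (s \<otimes> s')"
    using x y mult_S by (intro frac_eq_mem) auto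
qed

lemma loc_add:
  assumes x: "r \<in> carrier R" "s \<in> S" and y: "r' \<in> carrier R" "s' \<in> S"
  shows "loc_frac R S r s \<oplus>\<^bsub>localization R S\<^esub> loc_frac R S r' s' =
    loc_frac R S (r \<otimes> s' \<oplus> r' \<otimes> s) (s \<otimes> s')"
  unfolding localization_def ring.simps
proof (rule loc_op[OF x y])
  fix p q p' q' assume "(p, q) \<in> loc_frac R S r s" "(p', q') \<in> loc_frac R S r' s'"
  then obtain t t' where h: "p \<in> carrier R" "q \<in> S" "p' \<in> carrier R" "q' \<in> S" "t \<in> S" "t' \<in> S"
    and 1: "t \<otimes> (r \<otimes> q \<ominus> p \<otimes> s) = \<zero>" and 2: "t' \<otimes> (r' \<otimes> q' \<ominus> p' \<otimes> s') = \<zero>"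
    unfolding loc_frac_def by blast
  have c: "r \<in> carrier R" "s \<in> carrier R" "r' \<in> carrier R" "s' \<in> carrier R" "p \<in> carrier R"
    "q \<in> carrier R" "p' \<in> carrier R" "q' \<in> carrier R" "t \<in> carrier R" "t' \<in> carrier R"
    using h x y by auto
  have "(t \<otimes> t') \<otimes> ((r \<otimes> s' \<oplus> r' \<otimes> s) \<otimes> (q \<otimes> q') \<ominus> (p \<otimes> q' \<oplus> p' \<otimes> q) \<otimes> (s \<otimes> s')) =
     (t' \<otimes> s' \<otimes> q') \<otimes> (t \<otimes> (r \<otimes> q \<ominus> p \<otimes> s)) \<oplus> (t \<otimes> q \<otimes> s) \<otimes> (t' \<otimes> (r' \<otimes> q' \<ominus> p' \<otimes> s'))"
    using c by algebra
  also have "\<dots> = \<zero>" unfolding 1 2 using c by simp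
  finally have "(p \<otimes> q' \<oplus> p' \<otimes> q, q \<otimes> q') \<in> loc_frac R S (r \<otimes> s' \<oplus> r' \<otimes> s) (s \<otimes> s')"
    using h mult_S unfolding loc_frac_def by blast
  then show "loc_frac R S (p \<otimes> q' \<oplus> p' \<otimes> q) (q \<otimes> q') = loc_frac R S (r \<otimes> s' \<oplus> r' \<otimes> s) (s \<otimes> s')"
    using x y mult_S by (intro frac_eq_mem) auto
qed

lemma loc_carrier: "carrier (localization R S) = {loc_frac R S r s |r s. r \<in> carrier R \<and> s \<in> S}"
  and loc_one: "\<one>\<^bsub>localization R S\<^esub> = loc_frac R S \<one> \<one>"
  and loc_zero: "\<zero>\<^bsub>localization R S\<^esub> = loc_frac R S \<zero> \<one>"
  by (simp_all add: localization_def)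

lemma loc_carrierE:
  assumes "x \<in> carrier (localization R S)"
  obtains r s where "r \<in> carrier R" "s \<in> S" "x = loc_frac R S r s"
  using assms by (auto simp: loc_carrier)

lemma frac_closed: "\<lbrakk>r \<in> carrier R; s \<in> S\<rbrakk> \<Longrightarrow> loc_frac R S r s \<in> carrier (localization R S)"
  by (auto simp: loc_carrier)

lemma loc_add_closed:
  assumes "x \<in> carrier (localization R S)" "y \<in> carrier (localization R S)"
  shows "x \<oplus>\<^bsub>localization R S\<^esub> y \<in> carrier (localization R S)"
  using assms by (elim loc_carrierE) (simp add: loc_add frac_closed mult_S)

lemma loc_mult_closed:
  assumes "x \<in> carrier (localization R S)" "y \<in> carrier (localization R S)"
  shows "x \<otimes>\<^bsub>localization R S\<^esub> y \<in> carrier (localization R S)"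
  using assms by (elim loc_carrierE) (simp add: loc_mult frac_closed mult_S)

lemma cring_localization: "cring (localization R S)"
proof (rule cringI)
  show "abelian_group (localization R S)"
  proof (rule abelian_groupI)
    fix x y z assume "x \<in> carrier (localization R S)" "y \<in> carrier (localization R S)"
      "z \<in> carrier (localization R S)"
    then obtain r s r' s' r'' s'' where h: "r \<in> carrier R" "s \<in> S" "x = loc_frac R S r s"
      "r' \<in> carrier R" "s' \<in> S" "y = loc_frac R S r' s'"
      "r'' \<in> carrier R" "s'' \<in> S" "z = loc_frac R S r'' s''" by (elim loc_carrierE)
    have c: "s \<in> carrier R" "s' \<in> carrier R" "s'' \<in> carrier R" using h by auto
    have 1: "(r \<otimes> s' \<oplus> r' \<otimes> s) \<otimes> s'' \<oplus> r'' \<otimes> (s \<otimes> s') = r \<otimes> (s' \<otimes> s'') \<oplus> (r' \<otimes> s'' \<oplus> r'' \<otimes> s') \<otimes> s"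
      using h(1,4,7) c by algebra
    show "x \<oplus>\<^bsub>localization R S\<^esub> y \<oplus>\<^bsub>localization R S\<^esub> z = x \<oplus>\<^bsub>localization R S\<^esub> (y \<oplus>\<^bsub>localization R S\<^esub> z)"
      using h c 1 by (simp add: loc_add mult_S m_assoc)
  next
    fix x y assume "x \<in> carrier (localization R S)" "y \<in> carrier (localization R S)"
    then show "x \<oplus>\<^bsub>localization R S\<^esub> y = y \<oplus>\<^bsub>localization R S\<^esub> x"
      by (elim loc_carrierE) (simp add: loc_add m_comm a_comm)
  next
    fix x assume "x \<in> carrier (localization R S)"
    then obtain r s where x: "r \<in> carrier R" "s \<in> S" "x = loc_frac R S r s" by (elim loc_carrierE)
    show "\<zero>\<^bsub>localization R S\<^esub> \<oplus>\<^bsub>localization R S\<^esub> x = x"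
      using x one_S by (simp add: loc_add loc_zero)
    \<comment> \<open>The sum of -r/s and r/s has denominator s s, so the resulting zero has to be
      compared with 0/1.\<close>
    have "loc_frac R S \<zero> (s \<otimes> s) = loc_frac R S \<zero> \<one>"
      using x one_S by (intro frac_eqI) (simp_all add: mult_S)
    then have "loc_frac R S (\<ominus> r) s \<oplus>\<^bsub>localization R S\<^esub> x = \<zero>\<^bsub>localization R S\<^esub>"
      using x one_S by (simp add: loc_add loc_zero l_minus l_neg)
    then show "\<exists>y\<in>carrier (localization R S). y \<oplus>\<^bsub>localization R S\<^esub> x = \<zero>\<^bsub>localization R S\<^esub>"
      using x by (intro bexI[of _ "loc_frac R S (\<ominus> r) s"] frac_closed) auto
  next
    show "\<zero>\<^bsub>localization R S\<^esub> \<in> carrier (localization R S)"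
      by (simp add: loc_zero frac_closed one_S)
  qed (rule loc_add_closed)
  show "Group.comm_monoid (localization R S)"
  proof (rule comm_monoidI)
    fix x y z assume "x \<in> carrier (localization R S)" "y \<in> carrier (localization R S)"
      "z \<in> carrier (localization R S)"
    then show "x \<otimes>\<^bsub>localization R S\<^esub> y \<otimes>\<^bsub>localization R S\<^esub> z = x \<otimes>\<^bsub>localization R S\<^esub> (y \<otimes>\<^bsub>localization R S\<^esub> z)"
      by (elim loc_carrierE) (simp add: loc_mult mult_S m_assoc)
  next
    fix x y assume "x \<in> carrier (localization R S)" "y \<in> carrier (localization R S)"
    then show "x \<otimes>\<^bsub>localization R S\<^esub> y = y \<otimes>\<^bsub>localization R S\<^esub> x"
      by (elim loc_carrierE) (simp add: loc_mult mult_S m_comm)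
  next
    fix x assume "x \<in> carrier (localization R S)"
    then show "\<one>\<^bsub>localization R S\<^esub> \<otimes>\<^bsub>localization R S\<^esub> x = x"
      by (elim loc_carrierE) (simp add: loc_mult loc_one one_S)
  next
    show "\<one>\<^bsub>localization R S\<^esub> \<in> carrier (localization R S)"
      by (simp add: loc_one frac_closed one_S)
  qed (rule loc_mult_closed)
  fix x y z assume "x \<in> carrier (localization R S)" "y \<in> carrier (localization R S)"
    "z \<in> carrier (localization R S)"
  then obtain r s r' s' r'' s'' where h: "r \<in> carrier R" "s \<in> S" "x = loc_frac R S r s"
    "r' \<in> carrier R" "s' \<in> S" "y = loc_frac R S r' s'"
    "r'' \<in> carrier R" "s'' \<in> S" "z = loc_frac R S r'' s''" by (elim loc_carrierE)
  have c: "s \<in> carrier R" "s' \<in> carrier R" "s'' \<in> carrier R" using h by auto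
  \<comment> \<open>The two sides of distributivity come out with denominators (s s') s'' and (s
    s'') (s' s''); this is the cross-multiplied identity that \<open>frac_eqI\<close> asks
    for.\<close>
  have "(r \<otimes> s' \<oplus> r' \<otimes> s) \<otimes> r'' \<otimes> ((s \<otimes> s'') \<otimes> (s' \<otimes> s'')) =
    ((r \<otimes> r'') \<otimes> (s' \<otimes> s'') \<oplus> (r' \<otimes> r'') \<otimes> (s \<otimes> s'')) \<otimes> ((s \<otimes> s') \<otimes> s'')"
    using h(1,4,7) c by algebra
  then show "(x \<oplus>\<^bsub>localization R S\<^esub> y) \<otimes>\<^bsub>localization R S\<^esub> z =
     x \<otimes>\<^bsub>localization R S\<^esub> z \<oplus>\<^bsub>localization R S\<^esub> y \<otimes>\<^bsub>localization R S\<^esub> z"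
    using h c by (simp add: loc_add loc_mult mult_S) (rule frac_eqI, simp_all add: mult_S)
qed

end

end

section \<open>The tangent space at a rational point\<close>

lemma vec_space_simps [simp]:
  "carrier (vec_space C z pl sm) = C" "zero (vec_space C z pl sm) = z"
  "add (vec_space C z pl sm) = pl" "module.smult (vec_space C z pl sm) = sm"
  by (simp_all add: vec_space_def)

text \<open>The records built by \<open>vec_space\<close> carry no axioms. Closure of the source is
  what lets a map restricted to the carrier keep its linearity.\<close>

definition lin_closed :: "('k, 'w) module \<Rightarrow> bool" where
  "lin_closed V \<longleftrightarrow> (\<forall>x\<in>carrier V. \<forall>y\<in>carrier V. x \<oplus>\<^bsub>V\<^esub> y \<in> carrier V) \<and>
     (\<forall>c. \<forall>x\<in>carrier V. c \<odot>\<^bsub>V\<^esub> x \<in> carrier V)"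

lemma lin_isoI:
  assumes "lin_closed V" "\<And>x. x \<in> carrier V \<Longrightarrow> \<phi> x \<in> carrier W"
    and "\<And>x y. \<lbrakk>x \<in> carrier V; y \<in> carrier V\<rbrakk> \<Longrightarrow> \<phi> (x \<oplus>\<^bsub>V\<^esub> y) = \<phi> x \<oplus>\<^bsub>W\<^esub> \<phi> y"
    and "\<And>c x. x \<in> carrier V \<Longrightarrow> \<phi> (c \<odot>\<^bsub>V\<^esub> x) = c \<odot>\<^bsub>W\<^esub> \<phi> x"
    and "\<And>x y. \<lbrakk>x \<in> carrier V; y \<in> carrier V; \<phi> x = \<phi> y\<rbrakk> \<Longrightarrow> x = y"
    and "\<And>y. y \<in> carrier W \<Longrightarrow> \<exists>x\<in>carrier V. \<phi> x = y"
  shows "lin_iso V W"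
  unfolding lin_iso_def
proof
  show "restrict \<phi> (carrier V) \<in> lin_maps V W"
    using assms(1-4) by (auto simp: lin_maps_def lin_closed_def)
  show "bij_betw (restrict \<phi> (carrier V)) (carrier V) (carrier W)"
    unfolding bij_betw_def inj_on_def using assms(2,5,6) by (auto simp: image_iff) metis
qed

lemma lin_iso_trans:
  assumes "lin_closed V" "lin_iso V W" "lin_iso W Z"
  shows "lin_iso V Z"
proof -
  obtain \<phi> \<psi> where \<phi>: "\<phi> \<in> lin_maps V W" "bij_betw \<phi> (carrier V) (carrier W)"
    and \<psi>: "\<psi> \<in> lin_maps W Z" "bij_betw \<psi> (carrier W) (carrier Z)"
    using assms unfolding lin_iso_def by blast
  have 1: "\<phi> x \<in> carrier W" if "x \<in> carrier V" for x using \<phi>(1) that by (auto simp: lin_maps_def)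
  have 2: "\<psi> x \<in> carrier Z" if "x \<in> carrier W" for x using \<psi>(1) that by (auto simp: lin_maps_def)
  have b: "bij_betw (\<psi> \<circ> \<phi>) (carrier V) (carrier Z)" using bij_betw_trans[OF \<phi>(2) \<psi>(2)] .
  show ?thesis
  proof (rule lin_isoI[where \<phi> = "\<psi> \<circ> \<phi>", OF assms(1)])
    show "\<exists>x\<in>carrier V. (\<psi> \<circ> \<phi>) x = z" if "z \<in> carrier Z" for z
      using b that unfolding bij_betw_def by (metis imageE)
  qed (use \<phi> \<psi> 1 2 in \<open>auto simp: lin_maps_def bij_betw_def inj_on_def\<close>)
qed

text \<open>Here k is an A-module through \<open>ev\<close>. Vanishing on constants together with
  the Leibniz rule gives k-linearity.\<close>

definition point_derivations ::
  "('r, 'z) ring_scheme \<Rightarrow> ('r \<Rightarrow> 'k::field) \<Rightarrow> ('k \<Rightarrow> 'r) \<Rightarrow> ('k, 'r \<Rightarrow> 'k) module" where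
  "point_derivations A ev \<iota> = vec_space
     {\<delta> \<in> carrier A \<rightarrow>\<^sub>E UNIV.
        (\<forall>x\<in>carrier A. \<forall>y\<in>carrier A. \<delta> (x \<oplus>\<^bsub>A\<^esub> y) = \<delta> x + \<delta> y) \<and>
        (\<forall>x\<in>carrier A. \<forall>y\<in>carrier A. \<delta> (x \<otimes>\<^bsub>A\<^esub> y) = ev x * \<delta> y + ev y * \<delta> x) \<and>
        (\<forall>c. \<delta> (\<iota> c) = 0)}
     (\<lambda>x\<in>carrier A. 0)
     (\<lambda>\<delta> \<epsilon>. \<lambda>x\<in>carrier A. \<delta> x + \<epsilon> x)
     (\<lambda>c \<delta>. \<lambda>x\<in>carrier A. c * \<delta> x)"

text \<open>A k-point is encoded as a ring homomorphism \<open>ev\<close> that is a retraction of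
  the structure map \<iota>; its kernel \<open>pt\<close> then has residue field k.\<close>

locale rational_point = cring A for A (structure) +
  fixes ev :: "'a \<Rightarrow> 'k::field" and \<iota> :: "'k \<Rightarrow> 'a"
  assumes ev_add: "\<lbrakk>x \<in> carrier A; y \<in> carrier A\<rbrakk> \<Longrightarrow> ev (x \<oplus> y) = ev x + ev y"
    and ev_mult: "\<lbrakk>x \<in> carrier A; y \<in> carrier A\<rbrakk> \<Longrightarrow> ev (x \<otimes> y) = ev x * ev y"
    and ev_one: "ev \<one> = 1"
    and \<iota>_closed [simp, intro]: "\<iota> c \<in> carrier A"
    and ev_\<iota> [simp]: "ev (\<iota> c) = c"
    and \<iota>_add: "\<iota> (c + d) = \<iota> c \<oplus> \<iota> d"
    and \<iota>_mult: "\<iota> (c * d) = \<iota> c \<otimes> \<iota> d"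
begin

definition pt where "pt = {x \<in> carrier A. ev x = 0}"

lemma ev_zero: "ev \<zero> = 0"
  using ev_add[of \<zero> \<zero>] by (metis add_cancel_right_left l_zero zero_closed)

lemma ev_uminus: "x \<in> carrier A \<Longrightarrow> ev (\<ominus> x) = - ev x"
  using ev_add[of x "\<ominus> x"] by (simp add: r_neg ev_zero eq_neg_iff_add_eq_0 add.commute)

lemma ev_minus: "\<lbrakk>x \<in> carrier A; y \<in> carrier A\<rbrakk> \<Longrightarrow> ev (x \<ominus> y) = ev x - ev y"
  by (simp add: minus_eq ev_add ev_uminus)

lemma \<iota>_zero: "\<iota> 0 = \<zero>"
  using \<iota>_add[of 0 0] by (metis \<iota>_closed add_0 l_zero add.l_cancel_one' zero_closed)

lemma pt_mem: "x \<in> pt \<longleftrightarrow> x \<in> carrier A \<and> ev x = 0" by (simp add: pt_def)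

lemma compl_pt_mem: "x \<in> carrier A - pt \<longleftrightarrow> x \<in> carrier A \<and> ev x \<noteq> 0" by (auto simp: pt_def)

sublocale localizing_set A "carrier A - pt"
  by unfold_locales (auto simp: pt_def ev_one ev_mult)

section \<open>The local ring at the point and its cotangent space\<close>

abbreviation "L \<equiv> localization A (carrier A - pt)"
abbreviation "mm \<equiv> local_max_ideal A pt"
abbreviation "fr \<equiv> loc_frac A (carrier A - pt)"

text \<open>Membership in \<open>local_max_ideal\<close> only asks for some representative with
  numerator in \<open>pt\<close>. Applying \<open>ev\<close> to the equation that identifies two
  representatives, and cancelling the nonzero values of t and of the denominators, shows that every
  numerator vanishes at the point.\<close>

lemma mm_iff:
  assumes "x \<in> carrier A" "s \<in> carrier A - pt"
  shows "fr x s \<in> mm \<longleftrightarrow> ev x = 0"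
proof
  assume "fr x s \<in> mm"
  then obtain x' s' where h: "x' \<in> pt" "s' \<in> carrier A - pt" "fr x s = fr x' s'"
    unfolding local_max_ideal_def by blast
  obtain t where t: "t \<in> carrier A - pt" "t \<otimes> (x \<otimes> s' \<ominus> x' \<otimes> s) = \<zero>"
    using frac_eqD[OF assms _ h(2,3)] h(1) unfolding pt_mem by blast
  have "ev (t \<otimes> (x \<otimes> s' \<ominus> x' \<otimes> s)) = 0" by (simp only: t(2) ev_zero)
  then show "ev x = 0" using t(1) h(1,2) assms by (simp add: pt_mem ev_mult ev_minus)
qed (use assms in \<open>auto simp: local_max_ideal_def pt_mem\<close>)

lemma mmE:
  assumes "z \<in> mm"
  obtains x s where "x \<in> carrier A" "ev x = 0" "s \<in> carrier A - pt" "z = fr x s"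
  using assms by (auto simp: local_max_ideal_def pt_mem)

sublocale L: cring L by (rule cring_localization)

lemma mm_ideal: "ideal mm L"
proof (rule idealI)
  show "ring L" by (rule L.ring_axioms)
  have sub: "mm \<subseteq> carrier L" by (auto elim!: mmE intro: frac_closed)
  have mult: "z \<otimes>\<^bsub>L\<^esub> w \<in> mm" if zw: "z \<in> carrier L" "w \<in> mm" for z w
  proof -
    obtain r s where z: "r \<in> carrier A" "s \<in> carrier A - pt" "z = fr r s" using zw(1) by (elim loc_carrierE)
    obtain x t where w: "x \<in> carrier A" "ev x = 0" "t \<in> carrier A - pt" "w = fr x t"
      using zw(2) by (elim mmE)
    show ?thesis using z(1,2) w(1-3) unfolding z(3) w(4)
      by (subst loc_mult) (auto simp: mm_iff pt_mem ev_mult)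
  qed
  show "\<And>a x. \<lbrakk>a \<in> mm; x \<in> carrier L\<rbrakk> \<Longrightarrow> x \<otimes>\<^bsub>L\<^esub> a \<in> mm" by (rule mult)
  show "a \<otimes>\<^bsub>L\<^esub> x \<in> mm" if "a \<in> mm" "x \<in> carrier L" for a x
    using mult[OF that(2,1)] L.m_comm[OF subsetD[OF sub that(1)] that(2)] by (simp only:)
  show "subgroup mm (add_monoid L)"
  proof (rule L.add.subgroupI)
    show "mm \<subseteq> carrier L" by fact
    have "fr \<zero> \<one> \<in> mm" using one_S by (subst mm_iff) (auto simp: ev_zero)
    then show "mm \<noteq> {}" by blast
  next
    fix z assume z: "z \<in> mm"
    \<comment> \<open>Negation is multiplication by -1, so it is covered by the closure under
      multiples already shown.\<close>
    have "\<ominus>\<^bsub>L\<^esub> z = (\<ominus>\<^bsub>L\<^esub> \<one>\<^bsub>L\<^esub>) \<otimes>\<^bsub>L\<^esub> z" using z sub by (auto simp: L.l_minus)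
    then show "\<ominus>\<^bsub>L\<^esub> z \<in> mm" using mult z by simp
  next
    fix z w assume "z \<in> mm" "w \<in> mm"
    then obtain x s y t where "x \<in> carrier A" "ev x = 0" "s \<in> carrier A - pt" "z = fr x s"
      "y \<in> carrier A" "ev y = 0" "t \<in> carrier A - pt" "w = fr y t" by (elim mmE)
    then show "z \<oplus>\<^bsub>L\<^esub> w \<in> mm"
      by (auto simp: loc_add mm_iff pt_mem ev_mult ev_add)
  qed
qed

definition "mm2 = mm \<cdot>\<^bsub>L\<^esub> mm"

sublocale mm: ideal mm L by (rule mm_ideal)

sublocale mm2: ideal mm2 L unfolding mm2_def by (rule L.ideal_prod_is_ideal[OF mm_ideal mm_ideal])

definition "cls z = mm2 +>\<^bsub>L\<^esub> z"

lemma mm2_mult: "\<lbrakk>z \<in> mm; w \<in> mm\<rbrakk> \<Longrightarrow> z \<otimes>\<^bsub>L\<^esub> w \<in> mm2"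
  unfolding mm2_def by (rule ideal_prod.prod)

lemma mm2_subset: "mm2 \<subseteq> mm"
  using L.ideal_prod_inter[OF mm_ideal mm_ideal] unfolding mm2_def by blast

lemma cls_absorb: "\<lbrakk>w \<in> mm2; z \<in> carrier L\<rbrakk> \<Longrightarrow> cls (w \<oplus>\<^bsub>L\<^esub> z) = cls z"
  unfolding cls_def
  using L.a_repr_independence[OF L.a_rcosI _ mm2.a_subgroup] mm2.a_subset by metis

definition "cotan = cotangent_space (\<lambda>c. fr (\<iota> c) \<one>) L mm"

lemma cotan_carrier: "carrier cotan = cls ` mm"
  by (simp add: cotan_def cotangent_space_def Let_def mm2_def cls_def)

lemma cotan_add: "\<lbrakk>z \<in> carrier L; w \<in> carrier L\<rbrakk> \<Longrightarrow> cls z \<oplus>\<^bsub>cotan\<^esub> cls w = cls (z \<oplus>\<^bsub>L\<^esub> w)"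
  by (simp add: cotan_def cotangent_space_def Let_def mm2_def[symmetric] cls_def FactRing_def mm2.a_rcos_sum)

lemma cotan_smult: "z \<in> carrier L \<Longrightarrow> c \<odot>\<^bsub>cotan\<^esub> cls z = cls (fr (\<iota> c) \<one> \<otimes>\<^bsub>L\<^esub> z)"
  using one_S
  by (simp add: cotan_def cotangent_space_def Let_def mm2_def[symmetric] cls_def FactRing_def mm2.rcoset_mult_add frac_closed)

lemma tangent_eq: "zariski_tangent_space \<iota> A pt = dual_space cotan"
  by (simp add: zariski_tangent_space_def cotan_def local_ring_def)

lemma ideal_frac_mem: "\<lbrakk>x \<in> carrier A; ev x = 0; s \<in> carrier A - pt\<rbrakk> \<Longrightarrow> fr x s \<in> mm"
  by (simp add: mm_iff)

lemma mm_carrier: "z \<in> mm \<Longrightarrow> z \<in> carrier L" by (rule mm.a_Hcarr)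

text \<open>The difference of the two sides is \<open>(x/1) * ((1 - c s)/s)\<close> with \<open>c = 1/s(P)\<close>, a product of two
  elements of the maximal ideal.\<close>

lemma cls_frac:
  assumes "x \<in> carrier A" "ev x = 0" "s \<in> carrier A - pt"
  shows "cls (fr x s) = cls (fr (\<iota> (inverse (ev s)) \<otimes> x) \<one>)"
proof -
  let ?c = "\<iota> (inverse (ev s))"
  have s: "s \<in> carrier A" "ev s \<noteq> 0" using assms by (auto simp: pt_mem)
  have v: "ev (\<one> \<ominus> ?c \<otimes> s) = 0" using s by (simp add: ev_minus ev_mult ev_one)
  have m: "fr x \<one> \<otimes>\<^bsub>L\<^esub> fr (\<one> \<ominus> ?c \<otimes> s) s \<in> mm2"
    using assms s v one_S by (intro mm2_mult ideal_frac_mem) auto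
  have "x \<otimes> (\<one> \<ominus> ?c \<otimes> s) \<otimes> \<one> \<oplus> ?c \<otimes> x \<otimes> (\<one> \<otimes> s) = x"
    using assms(1) s(1) \<iota>_closed[of "inverse (ev s)"] by algebra
  then have "fr x s = fr x \<one> \<otimes>\<^bsub>L\<^esub> fr (\<one> \<ominus> ?c \<otimes> s) s \<oplus>\<^bsub>L\<^esub> fr (?c \<otimes> x) \<one>"
    using assms s one_S by (simp add: loc_mult loc_add pt_mem ev_mult)
  then show ?thesis using m assms one_S by (simp add: cls_absorb frac_closed)
qed

section \<open>From linear forms on the cotangent space to derivations\<close>

context
  fixes \<xi> assumes \<xi>: "\<xi> \<in> lin_maps cotan base_space"
begin

lemma \<xi>_add: "\<lbrakk>z \<in> mm; w \<in> mm\<rbrakk> \<Longrightarrow> \<xi> (cls (z \<oplus>\<^bsub>L\<^esub> w)) = \<xi> (cls z) + \<xi> (cls w)"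
  using \<xi> by (simp add: lin_maps_def cotan_carrier base_space_def cotan_add[symmetric] mm_carrier)

lemma \<xi>_smult: "z \<in> mm \<Longrightarrow> \<xi> (cls (fr (\<iota> c) \<one> \<otimes>\<^bsub>L\<^esub> z)) = c * \<xi> (cls z)"
  using \<xi> by (simp add: lin_maps_def cotan_carrier base_space_def cotan_smult[symmetric] mm_carrier)

text \<open>Adding z to itself does not change its class modulo \<open>mm2\<close>, so the value of
  \<xi> there equals twice itself; this works in every characteristic.\<close>

lemma \<xi>_mm2: "z \<in> mm2 \<Longrightarrow> \<xi> (cls z) = 0"
proof -
  assume z: "z \<in> mm2"
  have "\<xi> (cls (z \<oplus>\<^bsub>L\<^esub> z)) = \<xi> (cls z) + \<xi> (cls z)" using \<xi>_add z mm2_subset by blast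
  then show ?thesis using cls_absorb[OF z, of z] z mm2.a_Hcarr by (metis add_cancel_right_left)
qed

definition "\<tau> x = \<xi> (cls (fr x \<one>))"

lemma \<tau>_add: "\<lbrakk>x \<in> pt; y \<in> pt\<rbrakk> \<Longrightarrow> \<tau> (x \<oplus> y) = \<tau> x + \<tau> y"
  using \<xi>_add[of "fr x \<one>" "fr y \<one>"] one_S
  by (simp add: \<tau>_def pt_mem loc_add ideal_frac_mem)

lemma \<tau>_smult: "x \<in> pt \<Longrightarrow> \<tau> (\<iota> c \<otimes> x) = c * \<tau> x"
  using \<xi>_smult[of "fr x \<one>" c] one_S
  by (simp add: \<tau>_def pt_mem loc_mult ideal_frac_mem)

lemma \<tau>_mult: "\<lbrakk>x \<in> pt; y \<in> pt\<rbrakk> \<Longrightarrow> \<tau> (x \<otimes> y) = 0"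
  using \<xi>_mm2[OF mm2_mult, of "fr x \<one>" "fr y \<one>"] one_S
  by (simp add: \<tau>_def pt_mem loc_mult ideal_frac_mem)

text \<open>Subtracting the value at the point moves x into \<open>pt\<close>, the only place where
  \<tau> is controlled by \<xi>.\<close>

definition "der = (\<lambda>x\<in>carrier A. \<tau> (x \<ominus> \<iota> (ev x)))"

lemma shift_pt: "x \<in> carrier A \<Longrightarrow> x \<ominus> \<iota> (ev x) \<in> pt"
  by (simp add: pt_mem ev_minus)

text \<open>For the Leibniz rule, put p = x - x(P) and q = y - y(P). Then xy - x(P)y(P) = pq + x(P)
  q + y(P) p, and \<tau> kills pq because its image lies in the square of the maximal ideal.\<close>

lemma der_mem: "der \<in> carrier (point_derivations A ev \<iota>)"
proof -
  have 1: "der (x \<oplus> y) = der x + der y" if "x \<in> carrier A" "y \<in> carrier A" for x y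
  proof -
    have "x \<oplus> y \<ominus> (\<iota> (ev x) \<oplus> \<iota> (ev y)) = (x \<ominus> \<iota> (ev x)) \<oplus> (y \<ominus> \<iota> (ev y))"
      using that \<iota>_closed[of "ev x"] \<iota>_closed[of "ev y"] by algebra
    then show ?thesis using that by (simp add: der_def ev_add \<iota>_add \<tau>_add shift_pt)
  qed
  have 2: "der (x \<otimes> y) = ev x * der y + ev y * der x" if "x \<in> carrier A" "y \<in> carrier A" for x y
  proof -
    let ?p = "x \<ominus> \<iota> (ev x)" and ?q = "y \<ominus> \<iota> (ev y)"
    have pq: "?p \<in> pt" "?q \<in> pt" using that by (auto intro: shift_pt)
    have e: "x \<otimes> y \<ominus> \<iota> (ev x) \<otimes> \<iota> (ev y) = ?p \<otimes> ?q \<oplus> (\<iota> (ev x) \<otimes> ?q \<oplus> \<iota> (ev y) \<otimes> ?p)"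
      using that \<iota>_closed[of "ev x"] \<iota>_closed[of "ev y"] by algebra
    have "?p \<otimes> ?q \<in> pt" "\<iota> (ev x) \<otimes> ?q \<in> pt" "\<iota> (ev y) \<otimes> ?p \<in> pt"
      "\<iota> (ev x) \<otimes> ?q \<oplus> \<iota> (ev y) \<otimes> ?p \<in> pt"
      using pq by (simp_all add: pt_mem ev_mult ev_add)
    then show ?thesis
      using that pq by (simp add: der_def ev_mult \<iota>_mult e \<tau>_add \<tau>_smult \<tau>_mult)
  qed
  \<comment> \<open>A constant minus its value is zero, and zero is the product of two elements of
    \<open>pt\<close>, so \<open>\<tau>_mult\<close> applies.\<close>
  have 3: "der (\<iota> c) = 0" for c
    using \<tau>_mult[of \<zero> \<zero>] by (simp add: der_def minus_eq r_neg pt_mem ev_zero)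
  show ?thesis using 1 2 3 by (simp add: point_derivations_def) (simp add: der_def)
qed

text \<open>By \<open>cls_frac\<close> the class of x/s is that of x/1 scaled by 1/s(P). Hence \<xi>
  can be recovered from \<open>der\<close>, which gives injectivity.\<close>

lemma \<xi>_via_der:
  assumes "x \<in> carrier A" "ev x = 0" "s \<in> carrier A - pt"
  shows "\<xi> (cls (fr x s)) = der x / ev s"
proof -
  have "x \<in> pt" using assms by (simp add: pt_mem)
  moreover have "x \<ominus> \<zero> = x" using assms by (simp add: minus_eq)
  ultimately show ?thesis
    using assms \<tau>_smult[of x "inverse (ev s)"] unfolding cls_frac[OF assms]
    by (simp add: \<tau>_def[symmetric] der_def \<iota>_zero divide_inverse mult.commute)
qed

end

section \<open>From derivations back to linear forms on the cotangent space\<close>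

context
  fixes \<delta> assumes \<delta>: "\<delta> \<in> carrier (point_derivations A ev \<iota>)"
begin

lemma \<delta>_add: "\<lbrakk>x \<in> carrier A; y \<in> carrier A\<rbrakk> \<Longrightarrow> \<delta> (x \<oplus> y) = \<delta> x + \<delta> y"
  and \<delta>_mult: "\<lbrakk>x \<in> carrier A; y \<in> carrier A\<rbrakk> \<Longrightarrow> \<delta> (x \<otimes> y) = ev x * \<delta> y + ev y * \<delta> x"
  and \<delta>_\<iota>: "\<delta> (\<iota> c) = 0"
  using \<delta> by (simp_all add: point_derivations_def)

lemma \<delta>_zero: "\<delta> \<zero> = 0"
  using \<delta>_\<iota>[of 0] by (simp add: \<iota>_zero)

lemma \<delta>_minus: "\<lbrakk>x \<in> carrier A; y \<in> carrier A\<rbrakk> \<Longrightarrow> \<delta> (x \<ominus> y) = \<delta> x - \<delta> y"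
  using \<delta>_add[of x "\<ominus> y"] \<delta>_add[of y "\<ominus> y"]
  by (simp add: minus_eq r_neg \<delta>_zero) (simp add: eq_neg_iff_add_eq_0 add.commute)

text \<open>The quotient rule for \<open>\<delta> (x/s)\<close>, whose second term vanishes as \<open>ev x = 0\<close>; only meaningful on the
  maximal ideal.\<close>

definition "\<eta> z = (case SOME p. p \<in> z of (x, s) \<Rightarrow> \<delta> x / ev s)"

text \<open>Two representatives satisfy t (x s' - x' s) = 0. Applying \<open>ev\<close> shows that
  x' vanishes at the point as well; applying \<delta> then leaves only the terms with \<delta> x and
  \<delta> x', which says that the two quotients agree.\<close>

lemma \<eta>_frac:
  assumes "x \<in> carrier A" "ev x = 0" "s \<in> carrier A - pt"
  shows "\<eta> (fr x s) = \<delta> x / ev s"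
proof -
  obtain x' s' where p: "(SOME p. p \<in> fr x s) = (x', s')" by fastforce
  have "(x', s') \<in> fr x s" unfolding p[symmetric] using frac_refl[OF assms(1,3)] by (rule someI)
  then obtain t where h: "x' \<in> carrier A" "s' \<in> carrier A - pt" "t \<in> carrier A - pt"
    "t \<otimes> (x \<otimes> s' \<ominus> x' \<otimes> s) = \<zero>" unfolding loc_frac_def by blast
  note c = h(1) h(2,3)[unfolded compl_pt_mem] assms(1,3)[unfolded compl_pt_mem]
  have "ev (t \<otimes> (x \<otimes> s' \<ominus> x' \<otimes> s)) = 0" "\<delta> (t \<otimes> (x \<otimes> s' \<ominus> x' \<otimes> s)) = 0"
    unfolding h(4) ev_zero \<delta>_zero by auto
  then have "ev x' = 0" "\<delta> x * ev s' = \<delta> x' * ev s"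
    using c assms(2) by (auto simp: ev_mult ev_minus \<delta>_mult \<delta>_minus mult.commute)
  then show ?thesis using c unfolding \<eta>_def p by (simp add: field_simps)
qed

lemma \<eta>_add:
  assumes "z \<in> mm" "w \<in> mm" shows "\<eta> (z \<oplus>\<^bsub>L\<^esub> w) = \<eta> z + \<eta> w"
proof -
  obtain x s y t where h: "x \<in> carrier A" "ev x = 0" "s \<in> carrier A - pt" "z = fr x s"
    "y \<in> carrier A" "ev y = 0" "t \<in> carrier A - pt" "w = fr y t" using assms by (elim mmE)
  then show ?thesis
    by (auto simp: loc_add \<eta>_frac pt_mem ev_mult ev_add \<delta>_add \<delta>_mult pt_mem field_simps)
qed

text \<open>An element r/s acts through its value at the point: the Leibniz term in \<delta> r
  carries the value of a numerator from \<open>mm\<close>, which is 0. This serves both the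
  vanishing on \<open>mm2\<close> and the compatibility with scalars.\<close>

lemma \<eta>_mult:
  assumes "z \<in> carrier L" "w \<in> mm" "z = fr r s"  "r \<in> carrier A" "s \<in> carrier A - pt"
  shows "\<eta> (z \<otimes>\<^bsub>L\<^esub> w) = ev r / ev s * \<eta> w"
proof -
  obtain y t where h: "y \<in> carrier A" "ev y = 0" "t \<in> carrier A - pt" "w = fr y t"
    using assms by (elim mmE)
  then show ?thesis using assms
    by (auto simp: loc_mult \<eta>_frac pt_mem ev_mult \<delta>_mult pt_mem field_simps)
qed

lemma \<eta>_mm2: "z \<in> mm2 \<Longrightarrow> \<eta> z = 0"
proof -
  \<comment> \<open>Membership in \<open>mm\<close> is carried through the induction, since
    additivity of \<eta> is available only there.\<close>
  have "z \<in> mm \<and> \<eta> z = 0" if "z \<in> mm \<cdot>\<^bsub>L\<^esub> mm" for z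
    using that
  proof induction
    case (prod i j)
    obtain x s where "x \<in> carrier A" "ev x = 0" "s \<in> carrier A - pt" "i = fr x s"
      using prod by (elim mmE)
    then show ?case using prod \<eta>_mult[of i j x s] mm.I_l_closed mm_carrier by auto
  next
    case (sum s1 s2)
    then show ?case using \<eta>_add mm.a_closed by auto
  qed
  then show "z \<in> mm2 \<Longrightarrow> \<eta> z = 0" unfolding mm2_def by blast
qed

definition "tvec = (\<lambda>C\<in>cls ` mm. \<eta> (SOME z. z \<in> C))"

text \<open>The representative chosen in a coset differs from z by an element of \<open>mm2\<close>,
  on which \<eta> vanishes.\<close>

lemma tvec_cls: "z \<in> mm \<Longrightarrow> tvec (cls z) = \<eta> z"
proof -
  assume z: "z \<in> mm"
  have "z \<in> cls z" using mm2.a_rcos_self mm_carrier z by (simp add: cls_def)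
  then have "(SOME z'. z' \<in> cls z) \<in> cls z" by (rule someI)
  then obtain w where w: "w \<in> mm2" "(SOME z'. z' \<in> cls z) = w \<oplus>\<^bsub>L\<^esub> z"
    unfolding cls_def a_r_coset_def' by blast
  then show ?thesis using z mm2_subset by (simp add: tvec_def w \<eta>_add subset_iff \<eta>_mm2)
qed

lemma tvec_mem: "tvec \<in> lin_maps cotan base_space"
proof -
  have 1: "tvec (cls z \<oplus>\<^bsub>cotan\<^esub> cls w) = tvec (cls z) + tvec (cls w)" if "z \<in> mm" "w \<in> mm" for z w
    using that by (simp add: cotan_add mm_carrier tvec_cls \<eta>_add)
  have 2: "tvec (c \<odot>\<^bsub>cotan\<^esub> cls z) = c * tvec (cls z)" if "z \<in> mm" for z c
    using that one_S \<eta>_mult[of "fr (\<iota> c) \<one>" z "\<iota> c" \<one>]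
    by (simp add: cotan_smult mm_carrier tvec_cls mm.I_l_closed frac_closed ev_one)
  show ?thesis using 1 2 by (simp add: lin_maps_def cotan_carrier base_space_def) (simp add: tvec_def)
qed

lemma der_tvec: "der tvec = \<delta>"
proof
  fix x show "der tvec x = \<delta> x"
  proof (cases "x \<in> carrier A")
    case True
    have "x \<ominus> \<iota> (ev x) \<in> carrier A" "ev (x \<ominus> \<iota> (ev x)) = 0" using True by (auto simp: ev_minus)
    then show ?thesis using True one_S
      by (simp add: der_def[OF tvec_mem] \<tau>_def[OF tvec_mem] tvec_cls ideal_frac_mem \<eta>_frac ev_one
        \<delta>_minus \<delta>_\<iota>)
  next
    case False
    \<comment> \<open>Outside the carrier both sides are \<open>undefined\<close>, as derivations
      are extensional.\<close>
    have "\<delta> \<in> carrier A \<rightarrow>\<^sub>E UNIV" using \<delta> by (simp add: point_derivations_def)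
    from PiE_arb[OF this False] show ?thesis using False by (simp add: der_def[OF tvec_mem])
  qed
qed

end

lemma lin_closed_dual_cotan: "lin_closed (dual_space cotan)"
proof -
  have add: "x \<oplus>\<^bsub>cotan\<^esub> y \<in> carrier cotan" if "x \<in> carrier cotan" "y \<in> carrier cotan" for x y
    using that by (auto simp: cotan_carrier cotan_add mm_carrier mm.a_closed)
  have smult: "c \<odot>\<^bsub>cotan\<^esub> x \<in> carrier cotan" if "x \<in> carrier cotan" for x c
    using that one_S by (auto simp: cotan_carrier cotan_smult mm_carrier mm.I_l_closed frac_closed)
  show ?thesis
    by (auto simp: lin_closed_def dual_space_def lin_maps_def base_space_def add smult algebra_simps)
qed

text \<open>Every class is represented by a fraction from \<open>mm\<close>, so
  \<open>\<xi>_via_der\<close> yields injectivity of \<open>der\<close>; \<open>tvec\<close>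
  provides the preimages.\<close>

lemma tangent_iso_derivations: "lin_iso (zariski_tangent_space \<iota> A pt) (point_derivations A ev \<iota>)"
  unfolding tangent_eq
proof (rule lin_isoI[where \<phi> = der, OF lin_closed_dual_cotan])
  have c: "carrier (dual_space cotan) = lin_maps cotan base_space" by (simp add: dual_space_def)
  have cl: "cls (fr (x \<ominus> \<iota> (ev x)) \<one>) \<in> carrier cotan" if "x \<in> carrier A" for x
    using that one_S by (auto simp: cotan_carrier ideal_frac_mem ev_minus)
  show "der \<xi> \<in> carrier (point_derivations A ev \<iota>)" if "\<xi> \<in> carrier (dual_space cotan)" for \<xi>
    using that der_mem unfolding c by blast
  show "der (\<xi> \<oplus>\<^bsub>dual_space cotan\<^esub> \<zeta>) = der \<xi> \<oplus>\<^bsub>point_derivations A ev \<iota>\<^esub> der \<zeta>"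
    if h: "\<xi> \<in> carrier (dual_space cotan)" "\<zeta> \<in> carrier (dual_space cotan)" for \<xi> \<zeta>
  proof -
    have "\<xi> \<oplus>\<^bsub>dual_space cotan\<^esub> \<zeta> \<in> carrier (dual_space cotan)" using lin_closed_dual_cotan h by (simp add: lin_closed_def)
    then show ?thesis using h cl unfolding c
      by (auto simp: fun_eq_iff der_def \<tau>_def point_derivations_def dual_space_def)
  qed
  show "der (a \<odot>\<^bsub>dual_space cotan\<^esub> \<xi>) = a \<odot>\<^bsub>point_derivations A ev \<iota>\<^esub> der \<xi>"
    if h: "\<xi> \<in> carrier (dual_space cotan)" for \<xi> a
  proof -
    have "a \<odot>\<^bsub>dual_space cotan\<^esub> \<xi> \<in> carrier (dual_space cotan)" using lin_closed_dual_cotan h by (simp add: lin_closed_def)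
    then show ?thesis using h cl unfolding c
      by (auto simp: fun_eq_iff der_def \<tau>_def point_derivations_def dual_space_def)
  qed
  show "\<xi> = \<zeta>" if h: "\<xi> \<in> carrier (dual_space cotan)" "\<zeta> \<in> carrier (dual_space cotan)" "der \<xi> = der \<zeta>" for \<xi> \<zeta>
  proof (rule extensionalityI[of _ "carrier cotan"])
    show "\<xi> \<in> extensional (carrier cotan)" "\<zeta> \<in> extensional (carrier cotan)"
      using h unfolding c by (auto simp: lin_maps_def PiE_def)
    fix C assume "C \<in> carrier cotan"
    then show "\<xi> C = \<zeta> C" using h unfolding c cotan_carrier by (auto elim!: mmE simp: \<xi>_via_der)
  qed
  show "\<exists>\<xi>\<in>carrier (dual_space cotan). der \<xi> = \<delta>" if "\<delta> \<in> carrier (point_derivations A ev \<iota>)" for \<delta>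
    using tvec_mem der_tvec that unfolding c by blast
qed

lemma lin_closed_tangent: "lin_closed (zariski_tangent_space \<iota> A pt)"
  unfolding tangent_eq by (rule lin_closed_dual_cotan)

end

section \<open>Derivatives of polynomials\<close>

definition monom_val :: "('x \<Rightarrow> 'r) \<Rightarrow> ('x \<Rightarrow>\<^sub>0 nat) \<Rightarrow> 'r::comm_ring_1" where
  "monom_val v \<mu> = (\<Prod>x\<in>Poly_Mapping.keys \<mu>. v x ^ Poly_Mapping.lookup \<mu> x)"

text \<open>Substitution with a change of coefficients, so that ordinary evaluation and the jets
  below share one proof of being ring homomorphisms.\<close>

definition mp_hom :: "('k::comm_ring_1 \<Rightarrow> 'r::comm_ring_1) \<Rightarrow> ('x \<Rightarrow> 'r) \<Rightarrow> ('x, 'k) mpoly \<Rightarrow> 'r" where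
  "mp_hom h v p = (\<Sum>\<mu>\<in>Poly_Mapping.keys p. h (Poly_Mapping.lookup p \<mu>) * monom_val v \<mu>)"

lemma mp_eval_eq_hom: "mp_eval a = mp_hom (\<lambda>c. c) a"
  by (simp add: fun_eq_iff mp_eval_def mp_hom_def monom_val_def)

lemma monom_val_superset:
  assumes "finite F" "Poly_Mapping.keys \<mu> \<subseteq> F"
  shows "monom_val v \<mu> = (\<Prod>x\<in>F. v x ^ Poly_Mapping.lookup \<mu> x)"
  unfolding monom_val_def using assms
  by (intro prod.mono_neutral_left) (auto simp: in_keys_iff)

lemma monom_val_add: "monom_val v (\<mu> + \<nu>) = monom_val v \<mu> * monom_val v \<nu>"
proof -
  let ?F = "Poly_Mapping.keys \<mu> \<union> Poly_Mapping.keys \<nu>"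
  have "Poly_Mapping.keys (\<mu> + \<nu>) \<subseteq> ?F" by (rule Poly_Mapping.keys_add)
  then show ?thesis
    using monom_val_superset[of ?F "\<mu> + \<nu>" v] monom_val_superset[of ?F \<mu> v]
      monom_val_superset[of ?F \<nu> v]
    by (simp add: lookup_add power_add prod.distrib)
qed

lemma mpoly_sum_monomials:
  "(\<Sum>\<mu>\<in>Poly_Mapping.keys p. Poly_Mapping.single \<mu> (Poly_Mapping.lookup p \<mu>)) = p"
  by (rule poly_mapping_eqI) (simp add: lookup_sum lookup_single when_def in_keys_iff)

lemma mp_const_zero [simp]: "mp_const 0 = 0"
  and mp_const_one: "mp_const 1 = 1"
  and mp_const_add: "mp_const (c + d) = mp_const c + mp_const d"
  and mp_const_mult: "mp_const (c * d) = mp_const c * mp_const d"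
  by (simp_all add: mp_const_def single_add mult_single)

locale coeff_hom =
  fixes h :: "'k::comm_ring_1 \<Rightarrow> 'r::comm_ring_1" and v :: "'x \<Rightarrow> 'r"
  assumes h_add: "h (c + d) = h c + h d" and h_mult: "h (c * d) = h c * h d" and h_one: "h 1 = 1"
begin

lemma h_zero: "h 0 = 0"
  using h_add[of 0 0] by (metis add_cancel_right_left add_0)

lemma zero [simp]: "mp_hom h v 0 = 0"
  by (simp add: mp_hom_def)

lemma add: "mp_hom h v (p + q) = mp_hom h v p + mp_hom h v q"
  unfolding mp_hom_def by (rule setsum_keys_plus_distrib) (simp_all add: h_zero h_add algebra_simps)

lemma sum: "mp_hom h v (sum f I) = (\<Sum>i\<in>I. mp_hom h v (f i))"
  by (induction I rule: infinite_finite_induct) (simp_all add: add)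

lemma single: "mp_hom h v (Poly_Mapping.single \<mu> c) = h c * monom_val v \<mu>"
  by (simp add: mp_hom_def h_zero)

lemma mult: "mp_hom h v (p * q) = mp_hom h v p * mp_hom h v q"
proof -
  have "mp_hom h v (p * q) =
    mp_hom h v ((\<Sum>\<mu>\<in>Poly_Mapping.keys p. Poly_Mapping.single \<mu> (Poly_Mapping.lookup p \<mu>)) *
      (\<Sum>\<nu>\<in>Poly_Mapping.keys q. Poly_Mapping.single \<nu> (Poly_Mapping.lookup q \<nu>)))"
    by (simp only: mpoly_sum_monomials)
  also have "\<dots> = mp_hom h v p * mp_hom h v q"
    unfolding sum_product sum mult_single single monom_val_add h_mult mp_hom_def[of h v p] mp_hom_def[of h v q]
    by (simp add: mult.assoc mult.left_commute)
  finally show ?thesis .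
qed

lemma const [simp]: "mp_hom h v (mp_const c) = h c"
  unfolding mp_const_def single by (simp add: monom_val_def)

lemma var [simp]: "mp_hom h v (mp_var x) = v x"
  unfolding mp_var_def single by (simp add: monom_val_def h_one)

lemma diff: "mp_hom h v (p - q) = mp_hom h v p - mp_hom h v q"
  using add[of "p - q" q] by simp

end

lemma mp_ring_simps [simp]:
  "monoid.mult (mp_ring X) = (*)" "one (mp_ring X) = 1" "zero (mp_ring X) = 0" "add (mp_ring X) = (+)"
  by (simp_all add: mp_ring_def)

lemma mp_ring_carrier:
  "p \<in> carrier (mp_ring X) \<longleftrightarrow> (\<forall>\<mu>\<in>Poly_Mapping.keys p. Poly_Mapping.keys \<mu> \<subseteq> X)"
  by (simp add: mp_ring_def)

lemma mp_zero_closed [simp]: "0 \<in> carrier (mp_ring X)"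
  and mp_const_closed [simp]: "mp_const c \<in> carrier (mp_ring X)"
  and mp_var_closed [simp]: "x \<in> X \<Longrightarrow> mp_var x \<in> carrier (mp_ring X)"
  by (simp_all add: mp_ring_carrier mp_const_def mp_var_def)

lemma mp_one_closed [simp]: "1 \<in> carrier (mp_ring X)"
  using mp_const_closed[of 1] by (simp add: mp_const_one)

lemma mp_add_closed [simp]:
  "\<lbrakk>p \<in> carrier (mp_ring X); q \<in> carrier (mp_ring X)\<rbrakk> \<Longrightarrow> p + q \<in> carrier (mp_ring X)"
  unfolding mp_ring_carrier using Poly_Mapping.keys_add[of p q] by blast

lemma mp_mult_closed [simp]:
  "\<lbrakk>p \<in> carrier (mp_ring X); q \<in> carrier (mp_ring X)\<rbrakk> \<Longrightarrow> p * q \<in> carrier (mp_ring X)"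
  unfolding mp_ring_carrier
proof
  fix \<mu> assume h: "\<forall>\<mu>\<in>Poly_Mapping.keys p. Poly_Mapping.keys \<mu> \<subseteq> X"
    "\<forall>\<mu>\<in>Poly_Mapping.keys q. Poly_Mapping.keys \<mu> \<subseteq> X" and "\<mu> \<in> Poly_Mapping.keys (p * q)"
  then obtain \<mu>1 \<mu>2 where "\<mu>1 \<in> Poly_Mapping.keys p" "\<mu>2 \<in> Poly_Mapping.keys q" "\<mu> = \<mu>1 + \<mu>2"
    using keys_mult[of p q] by blast
  then show "Poly_Mapping.keys \<mu> \<subseteq> X" using h Poly_Mapping.keys_add[of \<mu>1 \<mu>2] by blast
qed

lemma mp_uminus_closed [simp]: "p \<in> carrier (mp_ring X) \<Longrightarrow> - p \<in> carrier (mp_ring X)"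
  by (auto simp: mp_ring_carrier in_keys_iff)

lemma mp_diff_closed [simp]:
  "\<lbrakk>p \<in> carrier (mp_ring X); q \<in> carrier (mp_ring X)\<rbrakk> \<Longrightarrow> p - q \<in> carrier (mp_ring X)"
  using mp_add_closed[of p X "- q"] by simp

lemma mp_sum_closed: "(\<And>i. i \<in> I \<Longrightarrow> f i \<in> carrier (mp_ring X)) \<Longrightarrow> sum f I \<in> carrier (mp_ring X)"
  by (induction I rule: infinite_finite_induct) simp_all

lemma cring_mp_ring: "cring (mp_ring X)"
proof (rule cringI)
  show "abelian_group (mp_ring X)"
  proof (rule abelian_groupI)
    show "\<exists>y\<in>carrier (mp_ring X). y \<oplus>\<^bsub>mp_ring X\<^esub> x = \<zero>\<^bsub>mp_ring X\<^esub>" if "x \<in> carrier (mp_ring X)" for x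
      using that by (intro bexI[of _ "- x"]) simp_all
  qed (simp_all add: add.assoc add.commute)
  show "Group.comm_monoid (mp_ring X)"
    by (rule comm_monoidI) (simp_all add: mult.assoc mult.commute)
qed (simp add: distrib_right)

lemma mp_ring_a_inv: "p \<in> carrier (mp_ring X) \<Longrightarrow> \<ominus>\<^bsub>mp_ring X\<^esub> p = - p"
proof -
  assume p: "p \<in> carrier (mp_ring X)"
  interpret R: cring "mp_ring X" by (rule cring_mp_ring)
  show ?thesis using R.minus_equality[of "- p" p] p by simp
qed

text \<open>The polynomial type admits all variables, while P is assumed only for those in X.
  Powers, monomials, terms and sums are built in turn; membership in the ring is carried along
  because the sum and product cases ask for it.\<close>

lemma mp_induct [consumes 1, case_names const var add mult]:
  fixes p :: "('x, 'k::comm_ring_1) mpoly"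
  assumes "p \<in> carrier (mp_ring X)"
    and const: "\<And>c. P (mp_const c)" and var: "\<And>x. x \<in> X \<Longrightarrow> P (mp_var x)"
    and add: "\<And>p q. \<lbrakk>p \<in> carrier (mp_ring X); q \<in> carrier (mp_ring X); P p; P q\<rbrakk> \<Longrightarrow> P (p + q)"
    and mult: "\<And>p q. \<lbrakk>p \<in> carrier (mp_ring X); q \<in> carrier (mp_ring X); P p; P q\<rbrakk> \<Longrightarrow> P (p * q)"
  shows "P p"
proof -
  let ?R = "carrier (mp_ring X) :: ('x, 'k) mpoly set"
  have pow: "Poly_Mapping.single (Poly_Mapping.single x n) 1 \<in> ?R \<and>
      P (Poly_Mapping.single (Poly_Mapping.single x n) 1)" if "x \<in> X" for x n
  proof (induction n)
    case 0
    show ?case using const[of 1] mp_const_closed[of 1 X] by (simp add: mp_const_def)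
  next
    case (Suc n)
    have e: "Poly_Mapping.single (Poly_Mapping.single x (Suc n)) (1 :: 'k) =
      mp_var x * Poly_Mapping.single (Poly_Mapping.single x n) 1"
      by (simp add: mp_var_def mult_single single_add[symmetric])
    show ?case unfolding e using that Suc by (auto intro: mult var)
  qed
  have mon: "Poly_Mapping.single (\<Sum>x\<in>F. Poly_Mapping.single x (n x)) 1 \<in> ?R \<and>
      P (Poly_Mapping.single (\<Sum>x\<in>F. Poly_Mapping.single x (n x)) 1)"
    if "finite F" "F \<subseteq> X" for F and n :: "_ \<Rightarrow> nat"
    using that
  proof (induction F)
    case empty
    show ?case using const[of 1] mp_const_closed[of 1 X] by (simp add: mp_const_def)
  next
    case (insert x F)
    have e: "Poly_Mapping.single (\<Sum>x\<in>insert x F. Poly_Mapping.single x (n x)) (1 :: 'k) =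
      Poly_Mapping.single (Poly_Mapping.single x (n x)) 1 *
      Poly_Mapping.single (\<Sum>x\<in>F. Poly_Mapping.single x (n x)) 1"
      using insert by (simp add: mult_single)
    show ?case unfolding e using insert pow[of x "n x"] by (auto intro: mult)
  qed
  have mono: "Poly_Mapping.single \<mu> c \<in> ?R \<and> P (Poly_Mapping.single \<mu> c)"
    if "Poly_Mapping.keys \<mu> \<subseteq> X" for \<mu> c
  proof -
    have m: "(\<Sum>x\<in>Poly_Mapping.keys \<mu>. Poly_Mapping.single x (Poly_Mapping.lookup \<mu> x)) = \<mu>"
      by (rule poly_mapping_eqI) (simp add: lookup_sum lookup_single when_def in_keys_iff)
    have e: "Poly_Mapping.single \<mu> c = mp_const c * Poly_Mapping.single \<mu> 1"
      by (simp add: mp_const_def mult_single)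
    show ?thesis unfolding e
      using mon[of "Poly_Mapping.keys \<mu>" "Poly_Mapping.lookup \<mu>"] that unfolding m by (auto intro: mult const)
  qed
  have "(\<Sum>\<mu>\<in>F. Poly_Mapping.single \<mu> (Poly_Mapping.lookup p \<mu>)) \<in> ?R \<and>
      P (\<Sum>\<mu>\<in>F. Poly_Mapping.single \<mu> (Poly_Mapping.lookup p \<mu>))"
    if "finite F" "F \<subseteq> Poly_Mapping.keys p" for F
    using that
  proof (induction F)
    case empty
    show ?case using const[of 0] by simp
  next
    case (insert \<mu> F)
    then have "Poly_Mapping.keys \<mu> \<subseteq> X" using assms(1) by (auto simp: mp_ring_carrier)
    then show ?case using insert mono[of \<mu> "Poly_Mapping.lookup p \<mu>"] by (auto intro: add)
  qed
  from this[of "Poly_Mapping.keys p"] show ?thesis by (simp add: mpoly_sum_monomials)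
qed

interpretation mp_eval: coeff_hom "\<lambda>c. c" a
  rewrites "mp_hom (\<lambda>c. c) a = mp_eval a" for a :: "'x \<Rightarrow> 'k::comm_ring_1"
  by unfold_locales (simp_all add: mp_eval_eq_hom)

text \<open>Evaluation at \<open>a + \<epsilon> d\<close>; modulo \<open>\<epsilon>\<^sup>2\<close> the result is the value at \<open>a\<close> plus \<open>\<epsilon>\<close> times the
  derivative in direction \<open>d\<close>.\<close>

definition mp_jet :: "('x \<Rightarrow> 'k) \<Rightarrow> ('x \<Rightarrow> 'k) \<Rightarrow> ('x, 'k::comm_ring_1) mpoly \<Rightarrow> 'k poly" where
  "mp_jet a d = mp_hom (\<lambda>c. [:c:]) (\<lambda>x. [:a x, d x:])"

definition mp_deriv :: "('x \<Rightarrow> 'k) \<Rightarrow> ('x \<Rightarrow> 'k) \<Rightarrow> ('x, 'k::comm_ring_1) mpoly \<Rightarrow> 'k" where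
  "mp_deriv a d p = coeff (mp_jet a d p) 1"

interpretation mp_jet: coeff_hom "\<lambda>c. [:c:]" "\<lambda>x. [:a x, d x:]"
  rewrites "mp_hom (\<lambda>c. [:c:]) (\<lambda>x. [:a x, d x:]) = mp_jet a d"
  for a d :: "'x \<Rightarrow> 'k::comm_ring_1"
  by unfold_locales (simp_all add: mp_jet_def one_pCons)

text \<open>Taking the constant coefficient is evaluation at \<epsilon> = 0, which commutes with the
  sums and products in \<open>mp_hom\<close>.\<close>

lemma coeff_0_mp_jet: "coeff (mp_jet a d p) 0 = mp_eval a p"
  by (simp add: mp_jet_def mp_hom_def mp_eval_eq_hom monom_val_def poly_0_coeff_0[symmetric] poly_sum poly_prod)

lemma mp_deriv_add: "mp_deriv a d (p + q) = mp_deriv a d p + mp_deriv a d q"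
  and mp_deriv_diff: "mp_deriv a d (p - q) = mp_deriv a d p - mp_deriv a d q"
  and mp_deriv_sum: "mp_deriv a d (sum f I) = (\<Sum>i\<in>I. mp_deriv a d (f i))"
  and mp_deriv_const [simp]: "mp_deriv a d (mp_const c) = 0"
  and mp_deriv_var [simp]: "mp_deriv a d (mp_var x) = d x"
  by (simp_all add: mp_deriv_def mp_jet.add mp_jet.diff mp_jet.sum coeff_sum)

text \<open>This is the coefficient of \<epsilon> in the product of two jets.\<close>

lemma mp_deriv_mult: "mp_deriv a d (p * q) = mp_eval a p * mp_deriv a d q + mp_eval a q * mp_deriv a d p"
  by (simp add: mp_deriv_def mp_jet.mult coeff_mult coeff_0_mp_jet mult.commute)

text \<open>The jet itself is not additive in the direction, because of higher powers of \<epsilon>.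
  Additivity of the linear coefficient is checked on constants and variables and passes through the
  sum and product rules.\<close>

lemma mp_deriv_add_dir:
  "mp_deriv a (\<lambda>x. d x + e x) p = mp_deriv a d p + mp_deriv a e p"
proof -
  have "p \<in> carrier (mp_ring UNIV)" by (simp add: mp_ring_carrier)
  then show ?thesis
    by (induction rule: mp_induct) (simp_all add: mp_deriv_add mp_deriv_mult algebra_simps)
qed

section \<open>The tangent space of a closed subscheme of affine space\<close>

text \<open>This is the kernel of substituting a + \<epsilon> d modulo
  \<open>\<epsilon>\<^sup>2\<close>. Because it is an ideal, tangency of d need only be tested on
  generators.\<close>

lemma tangent_ideal:
  "ideal {p \<in> carrier (mp_ring X). mp_eval a p = 0 \<and> mp_deriv a d p = 0} (mp_ring X)"
proof -
  interpret R: cring "mp_ring X" by (rule cring_mp_ring)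
  have z: "mp_eval a 0 = 0" "mp_deriv a d 0 = 0"
    using mp_deriv_const[of a d 0] by simp_all
  have m: "mp_eval a (- p) = - mp_eval a p" "mp_deriv a d (- p) = - mp_deriv a d p" for p
    using mp_eval.diff[of a 0 p] mp_deriv_diff[of a d 0 p] z by simp_all
  show ?thesis
    by (rule idealI[OF R.ring_axioms R.add.subgroupI])
      (auto simp: mp_eval.add mp_deriv_add mp_eval.mult mp_deriv_mult mp_ring_a_inv m z a_inv_def[symmetric]
        intro!: exI[of _ 0])
qed

text \<open>Tangent vectors at \<open>a\<close> to the zero scheme of G in the affine space with
  coordinates X.\<close>

definition jacobian_kernel ::
  "'x set \<Rightarrow> ('x \<Rightarrow> 'k) \<Rightarrow> ('x, 'k::field) mpoly set \<Rightarrow> ('k, 'x \<Rightarrow> 'k) module" where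
  "jacobian_kernel X a G = vec_space
     {d \<in> X \<rightarrow>\<^sub>E UNIV. \<forall>g\<in>G. mp_deriv a d g = 0}
     (\<lambda>x\<in>X. 0) (\<lambda>d e. \<lambda>x\<in>X. d x + e x) (\<lambda>c d. \<lambda>x\<in>X. c * d x)"

text \<open>The variables generate the polynomial ring as a k-algebra, so a derivation at
  \<open>a\<close> is determined by its values on them.\<close>

lemma derivation_eq_mp_deriv:
  fixes \<delta> :: "('x, 'k::field) mpoly \<Rightarrow> 'k"
  assumes add: "\<And>p q. \<lbrakk>p \<in> carrier (mp_ring X); q \<in> carrier (mp_ring X)\<rbrakk> \<Longrightarrow> \<delta> (p + q) = \<delta> p + \<delta> q"
    and mult: "\<And>p q. \<lbrakk>p \<in> carrier (mp_ring X); q \<in> carrier (mp_ring X)\<rbrakk> \<Longrightarrow>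
      \<delta> (p * q) = mp_eval a p * \<delta> q + mp_eval a q * \<delta> p"
    and const: "\<And>c. \<delta> (mp_const c) = 0" and var: "\<And>x. x \<in> X \<Longrightarrow> \<delta> (mp_var x) = d x"
    and p: "p \<in> carrier (mp_ring X)"
  shows "\<delta> p = mp_deriv a d p"
  using p by (induction rule: mp_induct) (simp_all add: add mult const var mp_deriv_add mp_deriv_mult)

locale affine_point =
  fixes X :: "'x set" and G :: "('x, 'k::field) mpoly set" and a :: "'x \<Rightarrow> 'k"
  assumes G_carrier: "G \<subseteq> carrier (mp_ring X)" and G_eval: "g \<in> G \<Longrightarrow> mp_eval a g = 0"
begin

sublocale R: cring "mp_ring X" by (rule cring_mp_ring)

definition "J = genideal (mp_ring X) G"
definition "cl p = J +>\<^bsub>mp_ring X\<^esub> p"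
definition "A = mp_ring X Quot J"
text \<open>The chosen representative is immaterial, because all of J vanishes at \<open>a\<close>
  (\<open>J_eval\<close>).\<close>

definition "evq C = mp_eval a (SOME p. p \<in> C)"

sublocale J: ideal J "mp_ring X" unfolding J_def by (rule R.genideal_ideal[OF G_carrier])

lemma J_deriv:
  assumes "\<forall>g\<in>G. mp_deriv a d g = 0" "p \<in> J"
  shows "mp_eval a p = 0" "mp_deriv a d p = 0"
proof -
  have "J \<subseteq> {p \<in> carrier (mp_ring X). mp_eval a p = 0 \<and> mp_deriv a d p = 0}"
    unfolding J_def using assms(1) G_carrier G_eval by (intro R.genideal_minimal[OF tangent_ideal]) auto
  then show "mp_eval a p = 0" "mp_deriv a d p = 0" using assms(2) by auto
qed

lemma J_eval: "p \<in> J \<Longrightarrow> mp_eval a p = 0"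
proof (rule J_deriv(1)[of "\<lambda>_. 0"])
  \<comment> \<open>The zero direction is always tangent: additivity in the direction makes this
    derivative equal to its own double.\<close>
  show "\<forall>g\<in>G. mp_deriv a (\<lambda>_. 0) g = 0"
    using mp_deriv_add_dir[of a "\<lambda>_. 0" "\<lambda>_. 0"] by (metis add_0 add_cancel_right_left)
qed

lemma A_carrier: "carrier A = cl ` carrier (mp_ring X)"
  by (auto simp: A_def FactRing_def A_RCOSETS_def' cl_def)

lemma A_ops:
  "\<lbrakk>p \<in> carrier (mp_ring X); q \<in> carrier (mp_ring X)\<rbrakk> \<Longrightarrow> cl p \<oplus>\<^bsub>A\<^esub> cl q = cl (p + q)"
  "\<lbrakk>p \<in> carrier (mp_ring X); q \<in> carrier (mp_ring X)\<rbrakk> \<Longrightarrow> cl p \<otimes>\<^bsub>A\<^esub> cl q = cl (p * q)"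
  "\<one>\<^bsub>A\<^esub> = cl 1" "\<zero>\<^bsub>A\<^esub> = J"
  using J.a_rcos_sum[of p q] J.rcoset_mult_add[of p q]
  by (simp_all add: A_def FactRing_def cl_def)

lemma cl_J: "p \<in> J \<Longrightarrow> cl p = \<zero>\<^bsub>A\<^esub>"
  unfolding cl_def by (simp add: A_ops J.a_rcos_const)

lemma cl_some:
  assumes "p \<in> carrier (mp_ring X)"
  obtains j where "j \<in> J" "(SOME q. q \<in> cl p) = j + p"
proof -
  have "p \<in> cl p" using J.a_rcos_self assms by (simp add: cl_def)
  then have "(SOME q. q \<in> cl p) \<in> cl p" by (rule someI)
  then show thesis using that unfolding cl_def a_r_coset_def' by auto
qed

lemma evq_cl:
  assumes "p \<in> carrier (mp_ring X)" shows "evq (cl p) = mp_eval a p"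
proof -
  obtain j where "j \<in> J" "(SOME q. q \<in> cl p) = j + p" using cl_some[OF assms] .
  then show ?thesis by (simp add: evq_def mp_eval.add J_eval)
qed

sublocale A: rational_point A evq "\<lambda>c. cl (mp_const c)"
proof (intro rational_point.intro rational_point_axioms.intro)
  show "cring A" unfolding A_def by (rule J.quotient_is_cring[OF R.is_cring])
qed (auto simp: A_carrier A_ops evq_cl mp_eval.add mp_eval.mult mp_const_add mp_const_mult
    mp_const_one[symmetric])

lemma pt_eq: "A.pt = {cl p |p. p \<in> carrier (mp_ring X) \<and> mp_eval a p = 0}"
  by (fastforce simp: A.pt_mem A_carrier evq_cl)

definition "der_lift d = (\<lambda>C\<in>carrier A. mp_deriv a d (SOME p. p \<in> C))"

lemma der_lift_cl:
  assumes "\<forall>g\<in>G. mp_deriv a d g = 0" "p \<in> carrier (mp_ring X)"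
  shows "der_lift d (cl p) = mp_deriv a d p"
proof -
  obtain j where "j \<in> J" "(SOME q. q \<in> cl p) = j + p" using cl_some[OF assms(2)] .
  then show ?thesis using assms by (simp add: der_lift_def A_carrier mp_deriv_add J_deriv)
qed

lemma derivation_cl:
  assumes "\<delta> \<in> carrier (point_derivations A evq (\<lambda>c. cl (mp_const c)))" "p \<in> carrier (mp_ring X)"
  shows "\<delta> (cl p) = mp_deriv a (\<lambda>x\<in>X. \<delta> (cl (mp_var x))) p"
  by (rule derivation_eq_mp_deriv[of X "\<lambda>p. \<delta> (cl p)"])
    (use assms in \<open>auto simp: point_derivations_def A_carrier A_ops evq_cl\<close>)

lemma lin_closed_derivations: "lin_closed (point_derivations A evq (\<lambda>c. cl (mp_const c)))"
  by (auto simp: lin_closed_def point_derivations_def algebra_simps)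

text \<open>A derivation of the quotient pulls back along \<open>cl\<close> to one of the polynomial
  ring that kills J, hence G; its values on the variables are thus a tangent direction and determine
  it. Conversely, a direction that kills G kills J and descends as \<open>der_lift\<close>.\<close>

lemma derivations_iso_kernel:
  "lin_iso (point_derivations A evq (\<lambda>c. cl (mp_const c))) (jacobian_kernel X a G)"
proof (rule lin_isoI[where \<phi> = "\<lambda>\<delta>. \<lambda>x\<in>X. \<delta> (cl (mp_var x))", OF lin_closed_derivations])
  let ?D = "point_derivations A evq (\<lambda>c. cl (mp_const c))"
  let ?\<phi> = "\<lambda>\<delta>. \<lambda>x\<in>X. \<delta> (cl (mp_var x))"
  have var: "cl (mp_var x) \<in> carrier A" if "x \<in> X" for x using that by (simp add: A_carrier)
  show "?\<phi> \<delta> \<in> carrier (jacobian_kernel X a G)" if \<delta>: "\<delta> \<in> carrier ?D" for \<delta>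
  proof -
    have "mp_deriv a (?\<phi> \<delta>) g = 0" if "g \<in> G" for g
    proof -
      have g: "g \<in> carrier (mp_ring X)" using that G_carrier by blast
      have "g \<in> J" unfolding J_def using R.genideal_self[OF G_carrier] that by blast
      then show ?thesis using derivation_cl[OF \<delta> g] A.\<delta>_zero[OF \<delta>] by (simp add: cl_J)
    qed
    then show ?thesis by (simp add: jacobian_kernel_def)
  qed
  show "?\<phi> (\<delta> \<oplus>\<^bsub>?D\<^esub> \<epsilon>) = ?\<phi> \<delta> \<oplus>\<^bsub>jacobian_kernel X a G\<^esub> ?\<phi> \<epsilon>" for \<delta> \<epsilon>
    using var by (auto simp: fun_eq_iff jacobian_kernel_def point_derivations_def)
  show "?\<phi> (c \<odot>\<^bsub>?D\<^esub> \<delta>) = c \<odot>\<^bsub>jacobian_kernel X a G\<^esub> ?\<phi> \<delta>" for c \<delta>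
    using var by (auto simp: fun_eq_iff jacobian_kernel_def point_derivations_def)
  show "\<delta> = \<epsilon>" if h: "\<delta> \<in> carrier ?D" "\<epsilon> \<in> carrier ?D" "?\<phi> \<delta> = ?\<phi> \<epsilon>" for \<delta> \<epsilon>
  proof (rule extensionalityI[of _ "carrier A"])
    show "\<delta> \<in> extensional (carrier A)" "\<epsilon> \<in> extensional (carrier A)"
      using h by (auto simp: point_derivations_def PiE_def)
    fix C assume "C \<in> carrier A"
    then obtain p where p: "p \<in> carrier (mp_ring X)" "C = cl p" by (auto simp: A_carrier)
    show "\<delta> C = \<epsilon> C" unfolding p(2) derivation_cl[OF h(1) p(1)] derivation_cl[OF h(2) p(1)] h(3) ..
  qed
  show "\<exists>\<delta>\<in>carrier ?D. ?\<phi> \<delta> = d" if "d \<in> carrier (jacobian_kernel X a G)" for d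
  proof
    have d: "d \<in> X \<rightarrow>\<^sub>E UNIV" "\<forall>g\<in>G. mp_deriv a d g = 0" using that by (auto simp: jacobian_kernel_def)
    show "der_lift d \<in> carrier ?D"
      using der_lift_cl[OF d(2)]
      by (simp add: point_derivations_def A_carrier A_ops evq_cl mp_deriv_add mp_deriv_mult)
        (simp add: der_lift_def A_carrier)
    show "?\<phi> (der_lift d) = d"
      by (rule extensionalityI[of _ X]) (use d(1) der_lift_cl[OF d(2)] in \<open>auto simp: PiE_def\<close>)
  qed
qed

lemma lin_closed_jacobian_kernel: "lin_closed (jacobian_kernel X a G)"
proof -
  \<comment> \<open>The directions are cut off outside X, which is harmless because these
    polynomials involve only variables from X.\<close>
  have "mp_deriv a (\<lambda>x\<in>X. d x + e x) g = mp_deriv a d g + mp_deriv a e g"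
    "mp_deriv a (\<lambda>x\<in>X. c * d x) g = c * mp_deriv a d g" if "g \<in> carrier (mp_ring X)" for c d e g
    using that by (induction rule: mp_induct) (simp_all add: mp_deriv_add mp_deriv_mult algebra_simps)
  then show ?thesis using G_carrier by (auto simp: lin_closed_def jacobian_kernel_def)
qed

theorem tangent_iso_jacobian_kernel:
  "lin_iso (zariski_tangent_space (\<lambda>c. cl (mp_const c)) A A.pt) (jacobian_kernel X a G)"
  using A.lin_closed_tangent A.tangent_iso_derivations derivations_iso_kernel by (rule lin_iso_trans)

end

section \<open>Charts of the Grassmannian\<close>

locale grass_chart = vector_space scale for scale :: "'k::field \<Rightarrow> 'b::ab_group_add \<Rightarrow> 'b" +
  fixes M U B I :: "'b set" and a :: "'b \<Rightarrow> 'b \<Rightarrow> 'k"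
  assumes fin_B: "finite B" and indep_B: "independent B" and span_B: "span B = M"
    and I_B: "I \<subseteq> B"
    and U_eq: "U = span ((\<lambda>l. l + (\<Sum>r\<in>B - I. scale (a r l) r)) ` I)"
begin

abbreviation "rp x b \<equiv> representation B x b"

definition "u l = l + (\<Sum>r\<in>B - I. scale (a r l) r)"

text \<open>Coordinates of \<open>x\<close> modulo \<open>U\<close>, with respect to the basis of \<open>M/U\<close> given by \<open>B - I\<close>.\<close>

definition "quot_coord x r = rp x r - (\<Sum>l\<in>I. a r l * rp x l)"

text \<open>The coordinates at I restrict on U to the basis dual to \<open>u\<close>, so on U this
  is the linear map sending u l to the sum of the d r l r. The formula makes sense on all of
  M.\<close>

definition "shift d x = (\<Sum>l\<in>I. \<Sum>r\<in>B - I. scale (rp x l * d r l) r)"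

lemma fin_I: "finite I" using fin_B I_B by (rule finite_subset[rotated])

lemma subspace_M: "subspace M" unfolding span_B[symmetric] by (rule subspace_span)

lemma subspace_U: "subspace U" unfolding U_eq by (rule subspace_span)

lemma U_span: "U = span (u ` I)" unfolding U_eq u_def ..

lemma B_M: "b \<in> B \<Longrightarrow> b \<in> M" unfolding span_B[symmetric] by (rule span_base)

lemma rp_add: "\<lbrakk>x \<in> M; y \<in> M\<rbrakk> \<Longrightarrow> rp (x + y) b = rp x b + rp y b"
  using representation_add[OF indep_B] by (simp add: span_B)

lemma rp_diff: "\<lbrakk>x \<in> M; y \<in> M\<rbrakk> \<Longrightarrow> rp (x - y) b = rp x b - rp y b"
  using representation_diff[OF indep_B] by (simp add: span_B)

lemma rp_scale: "x \<in> M \<Longrightarrow> rp (scale c x) b = c * rp x b"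
  using representation_scale[OF indep_B] by (simp add: span_B)

lemma rp_sum: "(\<And>i. i \<in> F \<Longrightarrow> g i \<in> M) \<Longrightarrow> rp (sum g F) b = (\<Sum>i\<in>F. rp (g i) b)"
  using representation_sum[OF indep_B, of F g] by (simp add: span_B)

lemma rp_basis: "b \<in> B \<Longrightarrow> rp b b' = (if b' = b then 1 else 0)"
  using representation_basis[OF indep_B] by simp

lemma scale_B_M: "b \<in> B \<Longrightarrow> scale c b \<in> M" using subspace_M B_M by (simp add: subspace_scale)

lemma sum_M: "(\<And>i. i \<in> F \<Longrightarrow> g i \<in> M) \<Longrightarrow> sum g F \<in> M"
  using subspace_M by (rule subspace_sum)

lemma rp_comb:
  assumes F: "F \<subseteq> B" "b \<in> B"
  shows "rp (\<Sum>r\<in>F. scale (c r) r) b = (if b \<in> F then c b else 0)"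
proof -
  from F have "finite F" using fin_B finite_subset by blast
  have "rp (\<Sum>r\<in>F. scale (c r) r) b = (\<Sum>r\<in>F. c r * (if b = r then 1 else 0))"
    using F by (subst rp_sum) (auto intro!: sum.cong simp: rp_scale rp_basis B_M scale_B_M subset_iff)
  also have "\<dots> = (\<Sum>r\<in>F. if r = b then c r else 0)" by (rule sum.cong) auto
  also have "\<dots> = (if b \<in> F then c b else 0)" using \<open>finite F\<close> by (simp add: sum.delta)
  finally show ?thesis .
qed

lemma comb_M: "F \<subseteq> B \<Longrightarrow> (\<Sum>r\<in>F. scale (c r) r) \<in> M"
  by (rule sum_M) (auto intro: scale_B_M)

lemma u_M: "l \<in> I \<Longrightarrow> u l \<in> M"
  unfolding u_def by (rule subspace_add[OF subspace_M B_M comb_M]) (use I_B in auto)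

lemma u_U: "l \<in> I \<Longrightarrow> u l \<in> U" unfolding U_span by (auto intro: span_base)

lemma U_M: "U \<subseteq> M"
  unfolding U_span using u_M subspace_M by (intro span_minimal) auto

lemma rp_u_in: "\<lbrakk>l \<in> I; l' \<in> I\<rbrakk> \<Longrightarrow> rp (u l) l' = (if l' = l then 1 else 0)"
  using I_B comb_M[of "B - I"] unfolding u_def
  by (subst rp_add) (auto simp: B_M rp_comb rp_basis subsetD)

lemma rp_u_out: "\<lbrakk>l \<in> I; r \<in> B - I\<rbrakk> \<Longrightarrow> rp (u l) r = a r l"
  using I_B comb_M[of "B - I"] unfolding u_def
  by (subst rp_add) (auto simp: B_M rp_comb rp_basis subsetD)

lemma quot_coord_add: "\<lbrakk>x \<in> M; y \<in> M\<rbrakk> \<Longrightarrow> quot_coord (x + y) r = quot_coord x r + quot_coord y r"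
  by (simp add: quot_coord_def rp_add sum.distrib algebra_simps)

lemma quot_coord_diff: "\<lbrakk>x \<in> M; y \<in> M\<rbrakk> \<Longrightarrow> quot_coord (x - y) r = quot_coord x r - quot_coord y r"
  by (simp add: quot_coord_def rp_diff sum_subtractf algebra_simps)

lemma quot_coord_scale: "x \<in> M \<Longrightarrow> quot_coord (scale c x) r = c * quot_coord x r"
  by (simp add: quot_coord_def rp_scale sum_distrib_left algebra_simps)

lemma quot_coord_u:
  assumes "l \<in> I" "r \<in> B - I" shows "quot_coord (u l) r = 0"
proof -
  have "(\<Sum>l'\<in>I. a r l' * rp (u l) l') = (\<Sum>l'\<in>I. if l' = l then a r l' else 0)"
    using assms by (intro sum.cong) (auto simp: rp_u_in)
  then show ?thesis using assms fin_I by (simp add: quot_coord_def rp_u_out sum.delta)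
qed

text \<open>This is the splitting of M into U and the span of B - I. Expanding \<open>u\<close>
  produces a double sum in the \<open>a r l\<close> that cancels against the correction term of
  \<open>quot_coord\<close>, leaving the expansion of x in the basis B.\<close>

lemma decomp:
  assumes "x \<in> M"
  shows "(\<Sum>l\<in>I. scale (rp x l) (u l)) + (\<Sum>r\<in>B - I. scale (quot_coord x r) r) = x"
proof -
  have 1: "(\<Sum>l\<in>I. scale (rp x l) (u l)) =
    (\<Sum>l\<in>I. scale (rp x l) l) + (\<Sum>l\<in>I. \<Sum>r\<in>B - I. scale (rp x l * a r l) r)"
    by (simp add: u_def scale_right_distrib scale_sum_right sum.distrib)
  have 2: "(\<Sum>l\<in>I. \<Sum>r\<in>B - I. scale (rp x l * a r l) r) = (\<Sum>r\<in>B - I. \<Sum>l\<in>I. scale (rp x l * a r l) r)"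
    by (rule sum.swap)
  have 3: "(\<Sum>r\<in>B - I. scale (quot_coord x r) r) =
    (\<Sum>r\<in>B - I. scale (rp x r) r) - (\<Sum>r\<in>B - I. \<Sum>l\<in>I. scale (rp x l * a r l) r)"
    by (simp add: quot_coord_def scale_left_diff_distrib scale_sum_left sum_subtractf mult.commute)
  have "(\<Sum>l\<in>I. scale (rp x l) l) + (\<Sum>r\<in>B - I. scale (rp x r) r) = (\<Sum>b\<in>B. scale (rp x b) b)"
    using sum.subset_diff[OF I_B fin_B, of "\<lambda>b. scale (rp x b) b"] by (simp add: add.commute)
  also have "\<dots> = x"
    using assms by (intro sum_representation_eq) (auto simp: indep_B span_B fin_B)
  finally show ?thesis unfolding 1 2 3 by simp
qed

text \<open>The coordinates modulo U vanish on the vectors \<open>u\<close>, hence on their span. If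
  they all vanish at x, then \<open>decomp\<close> writes x as a combination of the
  \<open>u\<close>.\<close>

lemma U_iff:
  assumes "x \<in> M" shows "x \<in> U \<longleftrightarrow> (\<forall>r\<in>B - I. quot_coord x r = 0)"
proof
  have "span (u ` I) \<subseteq> {x \<in> M. \<forall>r\<in>B - I. quot_coord x r = 0}"
  proof (rule span_minimal)
    show "u ` I \<subseteq> {x \<in> M. \<forall>r\<in>B - I. quot_coord x r = 0}" using u_M quot_coord_u by auto
    have "quot_coord 0 r = 0" for r using quot_coord_scale[of 0 0 r] subspace_M by (simp add: subspace_0)
    then show "subspace {x \<in> M. \<forall>r\<in>B - I. quot_coord x r = 0}"
      using subspace_M by (auto simp: subspace_def quot_coord_add quot_coord_scale)
  qed
  then show "x \<in> U \<Longrightarrow> \<forall>r\<in>B - I. quot_coord x r = 0" unfolding U_span by blast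
  assume "\<forall>r\<in>B - I. quot_coord x r = 0"
  then have "(\<Sum>l\<in>I. scale (rp x l) (u l)) = x" using decomp[OF assms] by simp
  moreover have "(\<Sum>l\<in>I. scale (rp x l) (u l)) \<in> U"
    using subspace_U u_U by (auto intro!: subspace_sum subspace_scale)
  ultimately show "x \<in> U" by simp
qed

lemma shift_eq: "shift d x = (\<Sum>r\<in>B - I. scale (\<Sum>l\<in>I. rp x l * d r l) r)"
  unfolding shift_def by (subst sum.swap) (simp add: scale_sum_left)

lemma shift_M: "shift d x \<in> M"
  unfolding shift_eq by (rule comb_M) auto

lemma shift_add: "\<lbrakk>x \<in> M; y \<in> M\<rbrakk> \<Longrightarrow> shift d (x + y) = shift d x + shift d y"
  by (simp add: shift_def rp_add scale_left_distrib distrib_right sum.distrib)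

lemma shift_scale: "x \<in> M \<Longrightarrow> shift d (scale c x) = scale c (shift d x)"
  by (simp add: shift_def rp_scale scale_sum_right mult.assoc)

lemma shift_add_dir:
  assumes "\<And>r l. r \<in> B - I \<Longrightarrow> l \<in> I \<Longrightarrow> d'' r l = d r l + d' r l"
  shows "shift d'' x = shift d x + shift d' x"
  using assms by (simp add: shift_def scale_left_distrib distrib_left sum.distrib)

lemma shift_scale_dir:
  assumes "\<And>r l. r \<in> B - I \<Longrightarrow> l \<in> I \<Longrightarrow> d' r l = c * d r l"
  shows "shift d' x = scale c (shift d x)"
  using assms by (simp add: shift_def scale_sum_right mult.left_commute)

text \<open>A shifted vector lies in the span of B - I, so its coordinates at I are zero and the
  correction term of \<open>quot_coord\<close> disappears.\<close>

lemma quot_coord_shift: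
  assumes "r \<in> B - I" shows "quot_coord (shift d x) r = (\<Sum>l\<in>I. rp x l * d r l)"
proof -
  have "rp (shift d x) l = 0" if "l \<in> I" for l
    using that I_B unfolding shift_eq by (subst rp_comb) auto
  moreover have "rp (shift d x) r = (\<Sum>l\<in>I. rp x l * d r l)"
    using assms unfolding shift_eq by (subst rp_comb) auto
  ultimately show ?thesis by (simp add: quot_coord_def)
qed

lemma sum_rp_u:
  assumes "l \<in> I" shows "(\<Sum>l'\<in>I. rp (u l) l' * c l') = c l"
proof -
  have "(\<Sum>l'\<in>I. rp (u l) l' * c l') = (\<Sum>l'\<in>I. if l' = l then c l' else 0)"
    using assms by (intro sum.cong) (auto simp: rp_u_in)
  then show ?thesis using assms fin_I by (simp add: sum.delta)
qed

text \<open>Recovers the direction d from the induced map into M/U; both injectivity and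
  surjectivity of \<open>hom_of\<close> rest on it.\<close>

lemma quot_coord_shift_u: "\<lbrakk>l \<in> I; r \<in> B - I\<rbrakk> \<Longrightarrow> quot_coord (shift d (u l)) r = d r l"
  by (simp add: quot_coord_shift sum_rp_u)

lemma shift_u: "l \<in> I \<Longrightarrow> shift d (u l) = (\<Sum>r\<in>B - I. scale (d r l) r)"
  by (simp add: shift_eq sum_rp_u)

end

section \<open>Cosets and quotient vector spaces\<close>

context vector_space
begin

lemma a_r_coset_subspace: "N +>\<^bsub>subspace_space scale M\<^esub> y = (\<lambda>x. x + y) ` N"
  by (auto simp: a_r_coset_def' subspace_space_def)

lemma coset_eq_iff:
  assumes "subspace N" shows "(\<lambda>x. x + y) ` N = (\<lambda>x. x + z) ` N \<longleftrightarrow> y - z \<in> N"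
proof
  assume "(\<lambda>x. x + y) ` N = (\<lambda>x. x + z) ` N"
  moreover have "0 + y \<in> (\<lambda>x. x + y) ` N" using assms by (intro imageI) (rule subspace_0)
  ultimately obtain x where "x \<in> N" "y = x + z" by auto
  then show "y - z \<in> N" by simp
next
  assume h: "y - z \<in> N"
  show "(\<lambda>x. x + y) ` N = (\<lambda>x. x + z) ` N"
  proof (intro subset_antisym image_subsetI)
    fix x assume "x \<in> N"
    then show "x + y \<in> (\<lambda>x. x + z) ` N" "x + z \<in> (\<lambda>x. x + y) ` N"
      using subspace_add[OF assms _ h] subspace_diff[OF assms _ h]
      by (auto intro: image_eqI[of _ _ "x + (y - z)"] image_eqI[of _ _ "x - (y - z)"])
  qed
qed

text \<open>Scalars and arrows act on cosets as unions over representatives. If g changes only by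
  elements of N' along a coset of N, all members of the union are the same coset.\<close>

lemma coset_image:
  assumes "subspace N" "subspace N'" "\<And>x. x \<in> N \<Longrightarrow> g (x + y) - g y \<in> N'"
  shows "(\<Union>x\<in>(\<lambda>x. x + y) ` N. (\<lambda>z. z + g x) ` N') = (\<lambda>z. z + g y) ` N'"
proof -
  have "(\<lambda>z. z + g (x + y)) ` N' = (\<lambda>z. z + g y) ` N'" if "x \<in> N" for x
    using assms that coset_eq_iff by blast
  moreover have "N \<noteq> {}" using subspace_0[OF assms(1)] by blast
  ultimately show ?thesis by simp
qed

context
  fixes M N :: "'b set"
  assumes M: "subspace M" and N: "subspace N"
begin

lemma quot_space_carrier: "carrier (quot_space (subspace_space scale M) N) = (\<lambda>y. (\<lambda>x. x + y) ` N) ` M"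
  by (auto simp: quot_space_def A_RCOSETS_def' a_r_coset_subspace) (auto simp: subspace_space_def)

lemma quot_space_add:
  "(\<lambda>x. x + y) ` N \<oplus>\<^bsub>quot_space (subspace_space scale M) N\<^esub> (\<lambda>x. x + z) ` N = (\<lambda>x. x + (y + z)) ` N"
proof -
  have "(\<lambda>x. x + y) ` N \<oplus>\<^bsub>quot_space (subspace_space scale M) N\<^esub> (\<lambda>x. x + z) ` N =
    {x + y + (x' + z) |x x'. x \<in> N \<and> x' \<in> N}"
    by (auto simp: quot_space_def set_add_def' subspace_space_def)
  also have "\<dots> = (\<lambda>x. x + (y + z)) ` N"
  proof safe
    fix x x' assume "x \<in> N" "x' \<in> N"
    then show "x + y + (x' + z) \<in> (\<lambda>x. x + (y + z)) ` N"
      using N by (intro image_eqI[of _ _ "x + x'"]) (auto intro: subspace_add simp: algebra_simps)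
  next
    fix x assume "x \<in> N"
    then show "\<exists>xa x'. x + (y + z) = xa + y + (x' + z) \<and> xa \<in> N \<and> x' \<in> N"
      using subspace_0[OF N] by (intro exI[of _ x] exI[of _ 0]) (auto simp: algebra_simps)
  qed
  finally show ?thesis .
qed

lemma quot_space_smult:
  "c \<odot>\<^bsub>quot_space (subspace_space scale M) N\<^esub> (\<lambda>x. x + y) ` N = (\<lambda>x. x + scale c y) ` N"
proof -
  have "c \<odot>\<^bsub>quot_space (subspace_space scale M) N\<^esub> (\<lambda>x. x + y) ` N =
    (\<Union>x\<in>(\<lambda>x. x + y) ` N. (\<lambda>z. z + scale c x) ` N)"
    by (simp add: quot_space_def a_r_coset_subspace del: UN_simps) (simp add: subspace_space_def)
  also have "\<dots> = (\<lambda>x. x + scale c y) ` N"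
    using N by (intro coset_image) (auto simp: scale_right_distrib subspace_scale)
  finally show ?thesis .
qed

end

end

section \<open>The quiver Grassmannian on a chart\<close>

locale quiver_chart = vector_space scale for scale :: "'k::field \<Rightarrow> 'b::ab_group_add \<Rightarrow> 'b" +
  fixes Q :: "('v, 'a) pre_digraph" and M U B I :: "'v \<Rightarrow> 'b set" and f :: "'a \<Rightarrow> 'b \<Rightarrow> 'b"
    and e :: "'v \<Rightarrow> nat" and a :: "'v \<times> 'b \<times> 'b \<Rightarrow> 'k"
  assumes wf: "wf_digraph Q" and rep: "is_fd_rep scale Q M f" and sub: "is_subrep scale Q M f U"
    and chart: "chart_at scale Q M e U B I a"
begin

abbreviation "bas i \<equiv> grass_chart.u scale (B i) (I i) (\<lambda>r l. a (i, r, l))"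
abbreviation "qc i \<equiv> grass_chart.quot_coord scale (B i) (I i) (\<lambda>r l. a (i, r, l))"
abbreviation "shf d i \<equiv> grass_chart.shift scale (B i) (I i) (\<lambda>r l. d (i, r, l))"
abbreviation "rp i \<equiv> representation (B i)"

lemma grass_chart: "i \<in> verts Q \<Longrightarrow> grass_chart scale (M i) (U i) (B i) (I i) (\<lambda>r l. a (i, r, l))"
proof unfold_locales
  assume i: "i \<in> verts Q"
  have c: "independent (B i)" "span (B i) = M i" "I i \<subseteq> B i"
    "U i = chart_point scale B I a i"
    using chart i by (auto simp: chart_at_def is_chart_def)
  \<comment> \<open>Finiteness of the basis comes from the finite spanning set of M i, which bounds
    every independent subset.\<close>
  obtain S where "finite S" "M i = span S" using rep i by (auto simp: is_fd_rep_def)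
  then show "finite (B i)"
    using independent_span_bound[of S "B i"] c span_superset[of "B i"] by auto
  show "independent (B i)" "span (B i) = M i" "I i \<subseteq> B i"
    "U i = span ((\<lambda>l. l + (\<Sum>r\<in>B i - I i. scale (a (i, r, l)) r)) ` I i)"
    using c by (auto simp: chart_point_def)
qed

lemma arc_verts: "h \<in> arcs Q \<Longrightarrow> tail Q h \<in> verts Q" "h \<in> arcs Q \<Longrightarrow> head Q h \<in> verts Q"
  using wf by (simp_all add: wf_digraph_def)

lemma f_M: "\<lbrakk>h \<in> arcs Q; x \<in> M (tail Q h)\<rbrakk> \<Longrightarrow> f h x \<in> M (head Q h)"
  and f_add: "\<lbrakk>h \<in> arcs Q; x \<in> M (tail Q h); y \<in> M (tail Q h)\<rbrakk> \<Longrightarrow> f h (x + y) = f h x + f h y"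
  and f_scale: "\<lbrakk>h \<in> arcs Q; x \<in> M (tail Q h)\<rbrakk> \<Longrightarrow> f h (scale c x) = scale c (f h x)"
  using rep by (auto simp: is_fd_rep_def)

lemma f_U: "\<lbrakk>h \<in> arcs Q; x \<in> U (tail Q h)\<rbrakk> \<Longrightarrow> f h x \<in> U (head Q h)"
  using sub unfolding is_subrep_def by blast

lemma subspaces: "i \<in> verts Q \<Longrightarrow> subspace (M i)" "i \<in> verts Q \<Longrightarrow> subspace (U i)"
  "i \<in> verts Q \<Longrightarrow> U i \<subseteq> M i"
  using sub rep by (auto simp: is_subrep_def is_fd_rep_def)

lemma f_comb:
  assumes h: "h \<in> arcs Q" and S: "S \<subseteq> M (tail Q h)"
  shows "f h (\<Sum>r\<in>S. scale (c r) r) = (\<Sum>r\<in>S. scale (c r) (f h r))"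
proof -
  have M: "subspace (M (tail Q h))" using h arc_verts subspaces by blast
  have 0: "f h 0 = 0" using f_scale[OF h subspace_0[OF M], of 0] by simp
  \<comment> \<open>Membership is proved together with the identity, since f h is additive only on
    the space at the tail. For infinite S both sums are 0 by convention.\<close>
  have "(\<Sum>r\<in>S. scale (c r) r) \<in> M (tail Q h) \<and>
      f h (\<Sum>r\<in>S. scale (c r) r) = (\<Sum>r\<in>S. scale (c r) (f h r))"
    using S
  proof (induction S rule: infinite_finite_induct)
    case (insert x F)
    then have "scale (c x) x \<in> M (tail Q h)" using subspace_scale[OF M] by simp
    then show ?case using insert subspace_add[OF M] by (simp add: f_add[OF h] f_scale[OF h])
  qed (simp_all add: subspace_0[OF M] 0)
  then show ?thesis ..
qed

definition "X = chart_coords Q B I"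
definition "G = {incidence_poly scale Q f B I h l r |h l r.
        h \<in> arcs Q \<and> l \<in> I (tail Q h) \<and> r \<in> B (head Q h) - I (head Q h)}"

text \<open>The polynomial is a coordinate of f h applied to the universal vector, and it is affine
  linear in the variables at the tail. Its value therefore uses u l, and its derivative uses the
  displacement of u l.\<close>

lemma image_coeff_value:
  assumes h: "h \<in> arcs Q" and l: "l \<in> I (tail Q h)"
  shows "mp_eval a (image_coeff scale Q f B I h l b) = rp (head Q h) (f h (bas (tail Q h) l)) b" (is ?eval)
    and "mp_deriv a d (image_coeff scale Q f B I h l b) =
      rp (head Q h) (f h (shf d (tail Q h) (bas (tail Q h) l))) b" (is ?deriv)
proof -
  interpret t: grass_chart scale "M (tail Q h)" "U (tail Q h)" "B (tail Q h)" "I (tail Q h)"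
    "\<lambda>r l. a (tail Q h, r, l)" using h arc_verts by (intro grass_chart)
  interpret s: grass_chart scale "M (head Q h)" "U (head Q h)" "B (head Q h)" "I (head Q h)"
    "\<lambda>r l. a (head Q h, r, l)" using h arc_verts by (intro grass_chart)
  have S: "B (tail Q h) - I (tail Q h) \<subseteq> M (tail Q h)" using t.B_M by blast
  have fS: "f h r \<in> M (head Q h)" "scale c (f h r) \<in> M (head Q h)"
    if "r \<in> B (tail Q h) - I (tail Q h)" for r c
  proof -
    show "f h r \<in> M (head Q h)" using that S f_M[OF h] by blast
    then show "scale c (f h r) \<in> M (head Q h)" by (rule subspace_scale[OF s.subspace_M])
  qed
  have comb: "rp (head Q h) (f h (\<Sum>r\<in>B (tail Q h) - I (tail Q h). scale (c r) r)) b =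
    (\<Sum>r\<in>B (tail Q h) - I (tail Q h). c r * rp (head Q h) (f h r) b)" for c
    using fS by (subst f_comb[OF h S], subst s.rp_sum) (auto intro!: sum.cong simp: s.rp_scale)
  have l': "l \<in> M (tail Q h)" using l t.I_B t.B_M by blast
  have cM: "(\<Sum>r\<in>B (tail Q h) - I (tail Q h). scale (c r) r) \<in> M (tail Q h)" for c
    by (rule t.comb_M) auto
  show ?eval
    unfolding image_coeff_def t.u_def f_add[OF h l' cM] s.rp_add[OF f_M[OF h l'] f_M[OF h cM]] comb
    by (simp add: mp_eval.add mp_eval.sum mp_eval.mult)
  show ?deriv
    unfolding image_coeff_def t.shift_u[OF l] comb
    by (simp add: mp_deriv_add mp_deriv_sum mp_deriv_mult mult.commute)
qed

text \<open>The value is a coordinate of f h (u l) modulo U at the head, which is zero because U is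
  a subrepresentation. In the product rule, differentiating the image coefficients gives the term f
  w u, and differentiating the variables at the head gives the term w f u, where w is the
  shift.\<close>

lemma incidence_poly_value:
  assumes h: "h \<in> arcs Q" and l: "l \<in> I (tail Q h)" and r: "r \<in> B (head Q h) - I (head Q h)"
  shows "mp_eval a (incidence_poly scale Q f B I h l r) = 0" (is ?eval)
    and "mp_deriv a d (incidence_poly scale Q f B I h l r) =
      qc (head Q h) (f h (shf d (tail Q h) (bas (tail Q h) l)) -
        shf d (head Q h) (f h (bas (tail Q h) l))) r" (is ?deriv)
proof -
  interpret t: grass_chart scale "M (tail Q h)" "U (tail Q h)" "B (tail Q h)" "I (tail Q h)"
    "\<lambda>r l. a (tail Q h, r, l)" using h arc_verts by (intro grass_chart)
  interpret s: grass_chart scale "M (head Q h)" "U (head Q h)" "B (head Q h)" "I (head Q h)"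
    "\<lambda>r l. a (head Q h, r, l)" using h arc_verts by (intro grass_chart)
  note v = image_coeff_value[OF h l]
  have u: "f h (bas (tail Q h) l) \<in> U (head Q h)" using f_U[OF h] t.u_U[OF l] by blast
  have uM: "f h (bas (tail Q h) l) \<in> M (head Q h)" using u s.U_M by blast
  have "mp_eval a (incidence_poly scale Q f B I h l r) = qc (head Q h) (f h (bas (tail Q h) l)) r"
    by (simp add: incidence_poly_def mp_eval.diff mp_eval.sum mp_eval.mult v s.quot_coord_def)
  then show ?eval using s.U_iff[OF uM] u r by simp
  have "mp_deriv a d (incidence_poly scale Q f B I h l r) =
    qc (head Q h) (f h (shf d (tail Q h) (bas (tail Q h) l))) r -
    (\<Sum>l'\<in>I (head Q h). rp (head Q h) (f h (bas (tail Q h) l)) l' * d (head Q h, r, l'))"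
    by (simp add: incidence_poly_def mp_deriv_diff mp_deriv_sum mp_deriv_mult v s.quot_coord_def
      sum.distrib)
  also have "\<dots> = qc (head Q h) (f h (shf d (tail Q h) (bas (tail Q h) l)) -
        shf d (head Q h) (f h (bas (tail Q h) l))) r"
    using s.quot_coord_shift[OF r, of "\<lambda>r l. d (head Q h, r, l)"]
    by (simp add: s.quot_coord_diff[OF f_M[OF h t.shift_M] s.shift_M])
  finally show ?deriv .
qed

lemma X_mem: "(i, r, l) \<in> X \<longleftrightarrow> i \<in> verts Q \<and> r \<in> B i - I i \<and> l \<in> I i"
  by (simp add: X_def chart_coords_def)

lemma G_closed: "G \<subseteq> carrier (mp_ring X)"
proof -
  have c: "image_coeff scale Q f B I h l b \<in> carrier (mp_ring X)"
    if "h \<in> arcs Q" "l \<in> I (tail Q h)" for h l b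
    unfolding image_coeff_def using that arc_verts[OF that(1)]
    by (intro mp_add_closed mp_const_closed mp_sum_closed mp_mult_closed mp_var_closed) (auto simp: X_mem)
  have "incidence_poly scale Q f B I h l r \<in> carrier (mp_ring X)"
    if "h \<in> arcs Q" "l \<in> I (tail Q h)" "r \<in> B (head Q h) - I (head Q h)" for h l r
    unfolding incidence_poly_def using that arc_verts[OF that(1)]
    by (intro mp_diff_closed mp_sum_closed mp_mult_closed mp_var_closed c) (auto simp: X_mem)
  then show ?thesis by (auto simp: G_def)
qed

lemma affine_point: "affine_point X G a"
  by unfold_locales (use G_closed incidence_poly_value(1) in \<open>auto simp: G_def\<close>)

lemma tangent_iso_kernel:
  "lin_closed (quiver_grass_tangent scale Q f B I a)"
  "lin_iso (quiver_grass_tangent scale Q f B I a) (jacobian_kernel X a G)"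
proof -
  interpret P: affine_point X G a by (rule affine_point)
  have J: "incidence_ideal scale Q f B I = P.J"
    unfolding incidence_ideal_def P.J_def unfolding X_def G_def ..
  have "quiver_grass_tangent scale Q f B I a = zariski_tangent_space (\<lambda>c. P.cl (mp_const c)) P.A P.A.pt"
    unfolding quiver_grass_tangent_def chart_ring_const_def[abs_def] chart_ring_def chart_ring_point_def
      J P.pt_eq by (simp add: P.cl_def P.A_def flip: X_def)
  then show "lin_closed (quiver_grass_tangent scale Q f B I a)"
    "lin_iso (quiver_grass_tangent scale Q f B I a) (jacobian_kernel X a G)"
    using P.A.lin_closed_tangent P.tangent_iso_jacobian_kernel by simp_all
qed

text \<open>For each arrow the commutator k of f h with the shifts is linear on the space at the
  tail. Vanishing of the derivatives says that k sends every basis vector u l into U at the head,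
  and by linearity this extends to their span.\<close>

lemma kernel_mem:
  "d \<in> carrier (jacobian_kernel X a G) \<longleftrightarrow> d \<in> X \<rightarrow>\<^sub>E UNIV \<and>
    (\<forall>h\<in>arcs Q. \<forall>x\<in>U (tail Q h). f h (shf d (tail Q h) x) - shf d (head Q h) (f h x) \<in> U (head Q h))"
proof -
  have "(\<forall>l\<in>I (tail Q h). \<forall>r\<in>B (head Q h) - I (head Q h).
      mp_deriv a d (incidence_poly scale Q f B I h l r) = 0) \<longleftrightarrow>
    (\<forall>x\<in>U (tail Q h). f h (shf d (tail Q h) x) - shf d (head Q h) (f h x) \<in> U (head Q h))"
    (is "?L \<longleftrightarrow> ?R") if h: "h \<in> arcs Q" for h
  proof -
    interpret t: grass_chart scale "M (tail Q h)" "U (tail Q h)" "B (tail Q h)" "I (tail Q h)"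
      "\<lambda>r l. a (tail Q h, r, l)" using h arc_verts by (intro grass_chart)
    interpret s: grass_chart scale "M (head Q h)" "U (head Q h)" "B (head Q h)" "I (head Q h)"
      "\<lambda>r l. a (head Q h, r, l)" using h arc_verts by (intro grass_chart)
    define k where "k x = f h (shf d (tail Q h) x) - shf d (head Q h) (f h x)" for x
    have kM: "k x \<in> M (head Q h)" if "x \<in> M (tail Q h)" for x
      unfolding k_def by (rule subspace_diff[OF s.subspace_M f_M[OF h t.shift_M] s.shift_M])
    have k_add: "k (x + y) = k x + k y" if "x \<in> M (tail Q h)" "y \<in> M (tail Q h)" for x y
      unfolding k_def t.shift_add[OF that] f_add[OF h that] s.shift_add[OF f_M[OF h that(1)] f_M[OF h that(2)]]
        f_add[OF h t.shift_M t.shift_M] by simp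
    have k_scale: "k (scale c x) = scale c (k x)" if "x \<in> M (tail Q h)" for x c
      unfolding k_def t.shift_scale[OF that] f_scale[OF h that] s.shift_scale[OF f_M[OF h that]]
        f_scale[OF h t.shift_M] by (simp add: scale_right_diff_distrib)
    have "?L \<longleftrightarrow> (\<forall>l\<in>I (tail Q h). k (bas (tail Q h) l) \<in> U (head Q h))"
      using kM[OF t.u_M] by (simp add: incidence_poly_value(2)[OF h] s.U_iff k_def)
    also have "\<dots> \<longleftrightarrow> (\<forall>x\<in>U (tail Q h). k x \<in> U (head Q h))"
    proof
      assume *: "\<forall>l\<in>I (tail Q h). k (bas (tail Q h) l) \<in> U (head Q h)"
      let ?T = "{x \<in> M (tail Q h). k x \<in> U (head Q h)}"
      have "subspace ?T"
        using t.subspace_M s.subspace_U k_scale[OF subspace_0[OF t.subspace_M], of 0]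
        by (simp add: subspace_def k_add k_scale)
      then have "U (tail Q h) \<subseteq> ?T"
        unfolding t.U_span using * t.u_M by (intro span_minimal) auto
      then show "\<forall>x\<in>U (tail Q h). k x \<in> U (head Q h)" by blast
    qed (use t.u_U in blast)
    finally show ?thesis unfolding k_def .
  qed
  then show ?thesis unfolding jacobian_kernel_def G_def vec_space_simps by blast
qed

section \<open>Tangent directions as homomorphisms from U to M/U\<close>

abbreviation "W \<equiv> quot_rep Q (rep_of scale M f) U"
definition "cs i y = (\<lambda>x. x + y) ` U i"

lemma cs_eq_iff: "i \<in> verts Q \<Longrightarrow> cs i y = cs i z \<longleftrightarrow> y - z \<in> U i"
  unfolding cs_def by (rule coset_eq_iff) (rule subspaces)

lemma W_space:
  assumes "i \<in> verts Q"
  shows "carrier (rep_space W i) = cs i ` M i"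
    "cs i y \<oplus>\<^bsub>rep_space W i\<^esub> cs i z = cs i (y + z)"
    "c \<odot>\<^bsub>rep_space W i\<^esub> cs i y = cs i (scale c y)"
  using quot_space_carrier[OF subspaces(1,2)[OF assms]] quot_space_add[OF subspaces(1,2)[OF assms]]
    quot_space_smult[OF subspaces(1,2)[OF assms]]
  by (simp_all add: quot_rep_def rep_of_def cs_def)

text \<open>The union over representatives is a single coset because f h maps U at the tail into U
  at the head.\<close>

lemma W_map:
  assumes h: "h \<in> arcs Q" and y: "y \<in> M (tail Q h)"
  shows "rep_map W h (cs (tail Q h) y) = cs (head Q h) (f h y)"
proof -
  note v = arc_verts[OF h]
  have "f h (x + y) - f h y \<in> U (head Q h)" if "x \<in> U (tail Q h)" for x
    using that f_U[OF h that] subspaces(3)[OF v(1)] y by (auto simp: f_add[OF h])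
  then show ?thesis
    using coset_image[OF subspaces(2)[OF v(1)] subspaces(2)[OF v(2)], of "f h" y]
    by (simp add: quot_rep_def rep_of_def cs_def a_r_coset_subspace del: UN_simps)
qed

lemma rep_hom_mem:
  "\<phi> \<in> carrier (rep_hom Q (rep_of scale U f) W) \<longleftrightarrow> \<phi> \<in> extensional (verts Q) \<and>
    (\<forall>i\<in>verts Q. \<phi> i \<in> U i \<rightarrow>\<^sub>E cs i ` M i \<and>
      (\<forall>x\<in>U i. \<forall>y\<in>U i. \<phi> i (x + y) = \<phi> i x \<oplus>\<^bsub>rep_space W i\<^esub> \<phi> i y) \<and>
      (\<forall>c. \<forall>x\<in>U i. \<phi> i (scale c x) = c \<odot>\<^bsub>rep_space W i\<^esub> \<phi> i x)) \<and>
    (\<forall>h\<in>arcs Q. \<forall>x\<in>U (tail Q h). \<phi> (head Q h) (f h x) = rep_map W h (\<phi> (tail Q h) x))"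
proof -
  have "rep_space (rep_of scale U f) i = subspace_space scale (U i)" "rep_map (rep_of scale U f) = f" for i
    by (simp_all add: rep_of_def)
  then show ?thesis
    by (auto simp: rep_hom_def lin_maps_def subspace_space_def PiE_iff W_space)
qed

definition "hom_of d = (\<lambda>i\<in>verts Q. \<lambda>x\<in>U i. cs i (shf d i x))"

text \<open>Compatibility with the arrows is the commutator condition of \<open>kernel_mem\<close>
  read modulo U at the head.\<close>

lemma hom_of_mem:
  assumes d: "d \<in> carrier (jacobian_kernel X a G)"
  shows "hom_of d \<in> carrier (rep_hom Q (rep_of scale U f) W)"
  unfolding rep_hom_mem
proof (intro conjI ballI)
  show "hom_of d \<in> extensional (verts Q)" by (simp add: hom_of_def)
next
  fix i assume i: "i \<in> verts Q"
  interpret t: grass_chart scale "M i" "U i" "B i" "I i" "\<lambda>r l. a (i, r, l)" using i by (rule grass_chart)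
  show "hom_of d i \<in> U i \<rightarrow>\<^sub>E cs i ` M i" using i t.shift_M by (auto simp: hom_of_def)
  show "hom_of d i (x + y) = hom_of d i x \<oplus>\<^bsub>rep_space W i\<^esub> hom_of d i y" if "x \<in> U i" "y \<in> U i" for x y
    using that i subspace_add[OF t.subspace_U that] t.U_M
    by (simp add: hom_of_def W_space t.shift_add subset_iff)
  show "\<forall>c. \<forall>x\<in>U i. hom_of d i (scale c x) = c \<odot>\<^bsub>rep_space W i\<^esub> hom_of d i x"
    using i subspace_scale[OF t.subspace_U] t.U_M
    by (simp add: hom_of_def W_space t.shift_scale subset_iff)
next
  fix h x assume h: "h \<in> arcs Q" and x: "x \<in> U (tail Q h)"
  note v = arc_verts[OF h]
  have "shf d (tail Q h) x \<in> M (tail Q h)" by (rule grass_chart.shift_M[OF grass_chart[OF v(1)]])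
  moreover have "f h (shf d (tail Q h) x) - shf d (head Q h) (f h x) \<in> U (head Q h)"
    using d h x unfolding kernel_mem by blast
  ultimately show "hom_of d (head Q h) (f h x) = rep_map W h (hom_of d (tail Q h) x)"
    using v x f_U[OF h x] by (simp add: hom_of_def W_map[OF h] cs_eq_iff[symmetric])
qed

text \<open>If two shifts of u l agree modulo U, the coordinates of their difference modulo U
  vanish; by \<open>quot_coord_shift_u\<close> these are the differences of the entries of d and
  d'.\<close>

lemma hom_of_inj:
  assumes d: "d \<in> carrier (jacobian_kernel X a G)" "d' \<in> carrier (jacobian_kernel X a G)"
    and eq: "hom_of d = hom_of d'"
  shows "d = d'"
proof (rule extensionalityI[of _ X])
  show "d \<in> extensional X" "d' \<in> extensional X" using d by (auto simp: kernel_mem PiE_def)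
  fix x assume "x \<in> X"
  then obtain i r l where x: "x = (i, r, l)" "i \<in> verts Q" "r \<in> B i - I i" "l \<in> I i"
    by (metis X_mem prod_cases3)
  interpret t: grass_chart scale "M i" "U i" "B i" "I i" "\<lambda>r l. a (i, r, l)" using x(2) by (rule grass_chart)
  have "cs i (shf d i (bas i l)) = cs i (shf d' i (bas i l))"
    using fun_cong[OF fun_cong[OF eq, of i], of "bas i l"] x t.u_U by (simp add: hom_of_def)
  then have "shf d i (bas i l) - shf d' i (bas i l) \<in> U i" using x by (simp add: cs_eq_iff)
  then have "qc i (shf d i (bas i l) - shf d' i (bas i l)) r = 0"
    using t.U_iff[OF subspace_diff[OF t.subspace_M t.shift_M t.shift_M]] x by blast
  then show "d x = d' x"
    using t.quot_coord_shift_u[OF x(4,3)] by (simp add: x t.quot_coord_diff[OF t.shift_M t.shift_M])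
qed

lemma hom_of_surj:
  assumes \<phi>: "\<phi> \<in> carrier (rep_hom Q (rep_of scale U f) W)"
  shows "\<exists>d\<in>carrier (jacobian_kernel X a G). hom_of d = \<phi>"
proof -
  \<comment> \<open>The direction at (i, r, l) is the r-th coordinate modulo U of a lift of \<phi>
    (u l) to M i. Any lift gives the same coordinate, so an arbitrary one is chosen.\<close>
  define d where "d = (\<lambda>(i, r, l)\<in>X. qc i (SOME y. y \<in> M i \<and> \<phi> i (bas i l) = cs i y) r)"
  have eq: "\<phi> i x = cs i (shf d i x)" if i: "i \<in> verts Q" and x: "x \<in> U i" for i x
  proof -
    interpret t: grass_chart scale "M i" "U i" "B i" "I i" "\<lambda>r l. a (i, r, l)" using i by (rule grass_chart)
    have \<phi>i: "\<phi> i \<in> U i \<rightarrow>\<^sub>E cs i ` M i"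
      "\<And>x y. x \<in> U i \<Longrightarrow> y \<in> U i \<Longrightarrow> \<phi> i (x + y) = \<phi> i x \<oplus>\<^bsub>rep_space W i\<^esub> \<phi> i y"
      "\<And>c x. x \<in> U i \<Longrightarrow> \<phi> i (scale c x) = c \<odot>\<^bsub>rep_space W i\<^esub> \<phi> i x"
      using \<phi> i unfolding rep_hom_mem by blast+
    have b: "\<phi> i (bas i l) = cs i (shf d i (bas i l))" if l: "l \<in> I i" for l
    proof -
      define y where "y = (SOME y. y \<in> M i \<and> \<phi> i (bas i l) = cs i y)"
      have "\<exists>y. y \<in> M i \<and> \<phi> i (bas i l) = cs i y" using \<phi>i(1) t.u_U[OF l] by blast
      then have y: "y \<in> M i" "\<phi> i (bas i l) = cs i y" unfolding y_def by (metis (mono_tags, lifting) someI_ex)+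
      have "qc i (y - shf d i (bas i l)) r = 0" if r: "r \<in> B i - I i" for r
        unfolding t.quot_coord_diff[OF y(1) t.shift_M] t.quot_coord_shift_u[OF l r]
        using i r l by (simp add: d_def X_mem y_def)
      then have "y - shf d i (bas i l) \<in> U i"
        using t.U_iff[OF subspace_diff[OF t.subspace_M y(1) t.shift_M]] by blast
      then show ?thesis unfolding y(2) using i by (simp add: cs_eq_iff)
    qed
    \<comment> \<open>The set where \<phi> i agrees with the map built from d is a subspace
      containing the spanning vectors u l, hence all of U i.\<close>
    let ?T = "{x \<in> U i. \<phi> i x = cs i (shf d i x)}"
    have "subspace ?T"
      unfolding subspace_def
    proof (intro conjI ballI allI)
      have 0: "0 \<in> U i" "0 \<in> M i" using subspace_0 t.subspace_U t.subspace_M by auto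
      obtain y where "\<phi> i 0 = cs i y" using \<phi>i(1) 0 by blast
      \<comment> \<open>The value at 0 follows from homogeneity: 0 is 0 times 0, and the scalar 0
        sends every coset to that of 0.\<close>
      then have "\<phi> i (scale 0 0) = cs i 0" using 0 i by (simp only: \<phi>i(3) W_space) simp
      moreover have "shf d i 0 = 0" using t.shift_scale[OF 0(2), of _ 0] by simp
      ultimately show "0 \<in> ?T" using 0 by simp
    next
      fix x y assume "x \<in> ?T" "y \<in> ?T"
      then show "x + y \<in> ?T"
        using i subspace_add[OF t.subspace_U] t.U_M by (simp add: \<phi>i(2) W_space t.shift_add subset_iff)
    next
      fix x c assume "x \<in> ?T"
      then show "scale c x \<in> ?T"
        using i subspace_scale[OF t.subspace_U] t.U_M by (simp add: \<phi>i(3) W_space t.shift_scale subset_iff)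
    qed
    then have "U i \<subseteq> ?T"
      unfolding t.U_span using b t.u_U by (intro span_minimal) (auto simp: t.U_span[symmetric])
    then show ?thesis using x by blast
  qed
  have ext: "\<phi> \<in> extensional (verts Q)" "\<And>i. i \<in> verts Q \<Longrightarrow> \<phi> i \<in> extensional (U i)"
    using \<phi> unfolding rep_hom_mem by (auto simp: PiE_def)
  have hom: "hom_of d = \<phi>"
  proof (rule extensionalityI[of _ "verts Q"])
    show "hom_of d i = \<phi> i" if i: "i \<in> verts Q" for i
      by (rule extensionalityI[of _ "U i"]) (use i ext eq in \<open>auto simp: hom_of_def\<close>)
  qed (use ext in \<open>auto simp: hom_of_def\<close>)
  have "d \<in> carrier (jacobian_kernel X a G)"
    unfolding kernel_mem
  proof (intro conjI ballI)
    show "d \<in> X \<rightarrow>\<^sub>E UNIV" by (simp add: d_def)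
    fix h x assume h: "h \<in> arcs Q" and x: "x \<in> U (tail Q h)"
    note v = arc_verts[OF h]
    have "cs (head Q h) (shf d (head Q h) (f h x)) = \<phi> (head Q h) (f h x)"
      using eq[OF v(2) f_U[OF h x]] ..
    also have "\<dots> = rep_map W h (\<phi> (tail Q h) x)" using \<phi> h x unfolding rep_hom_mem by blast
    also have "\<dots> = cs (head Q h) (f h (shf d (tail Q h) x))"
      unfolding eq[OF v(1) x] by (rule W_map[OF h grass_chart.shift_M[OF grass_chart[OF v(1)]]])
    finally show "f h (shf d (tail Q h) x) - shf d (head Q h) (f h x) \<in> U (head Q h)"
      using cs_eq_iff[OF v(2)] by metis
  qed
  then show ?thesis using hom by blast
qed

lemma kernel_iso_hom:
  "lin_iso (jacobian_kernel X a G) (rep_hom Q (rep_of scale U f) W)"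
proof (rule lin_isoI[where \<phi> = hom_of])
  interpret P: affine_point X G a by (rule affine_point)
  show "lin_closed (jacobian_kernel X a G)" by (rule P.lin_closed_jacobian_kernel)
  show "hom_of (d \<oplus>\<^bsub>jacobian_kernel X a G\<^esub> d') =
    hom_of d \<oplus>\<^bsub>rep_hom Q (rep_of scale U f) W\<^esub> hom_of d'" for d d'
  proof -
    have "shf (\<lambda>x\<in>X. d x + d' x) i x = shf d i x + shf d' i x" if "i \<in> verts Q" for i x
      using that by (intro grass_chart.shift_add_dir[OF grass_chart]) (auto simp: X_mem)
    then show ?thesis
      by (auto simp: fun_eq_iff hom_of_def jacobian_kernel_def rep_hom_def W_space)
        (simp_all add: rep_of_def subspace_space_def)
  qed
  show "hom_of (c \<odot>\<^bsub>jacobian_kernel X a G\<^esub> d) = c \<odot>\<^bsub>rep_hom Q (rep_of scale U f) W\<^esub> hom_of d" for c d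
  proof -
    have "shf (\<lambda>x\<in>X. c * d x) i x = scale c (shf d i x)" if "i \<in> verts Q" for i x
      using that by (intro grass_chart.shift_scale_dir[OF grass_chart]) (auto simp: X_mem)
    then show ?thesis
      by (auto simp: fun_eq_iff hom_of_def jacobian_kernel_def rep_hom_def W_space)
        (simp_all add: rep_of_def subspace_space_def)
  qed
qed (use hom_of_mem hom_of_inj hom_of_surj in blast)+

theorem tangent_iso_hom:
  "lin_iso (quiver_grass_tangent scale Q f B I a) (rep_hom Q (rep_of scale U f) W)"
  using tangent_iso_kernel kernel_iso_hom by (rule lin_iso_trans)

end

section \<open>Existence of a chart around U\<close>

lemma (in vector_space) chart_exists:
  assumes "is_fd_rep scale Q M f" "is_subrep scale Q M f U" "has_dim_vector scale Q U e"
  shows "\<exists>B I a. chart_at scale Q M e U B I a"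
proof -
  have "\<exists>B I. I \<subseteq> B \<and> independent B \<and> span B = M i \<and> span I = U i \<and> card I = e i"
    if i: "i \<in> verts Q" for i
  proof -
    have h: "subspace (M i)" "subspace (U i)" "U i \<subseteq> M i" "dim (U i) = e i"
      using assms i by (auto simp: is_fd_rep_def is_subrep_def has_dim_vector_def)
    obtain I where I: "I \<subseteq> U i" "independent I" "U i \<subseteq> span I" "card I = dim (U i)"
      using basis_exists by blast
    obtain B where B: "I \<subseteq> B" "B \<subseteq> M i" "independent B" "M i \<subseteq> span B"
      using maximal_independent_subset_extend[of I "M i"] I h by blast
    have "span B = M i" using span_minimal[OF B(2) h(1)] B(4) by (rule subset_antisym)
    moreover have "span I = U i" using span_minimal[OF I(1) h(2)] I(3) by (rule subset_antisym)
    ultimately show ?thesis using B(1,3) I(4) h(4) by (intro exI[of _ B] exI[of _ I]) simp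
  qed
  then obtain B I where "\<forall>i\<in>verts Q. I i \<subseteq> B i \<and> independent (B i) \<and> span (B i) = M i \<and>
      span (I i) = U i \<and> card (I i) = e i"
    by metis
  \<comment> \<open>With I i a basis of U i and B i an extension of it to a basis of M i, the point
    U is the origin of the chart.\<close>
  then have "chart_at scale Q M e U B I (\<lambda>_. 0)"
    by (auto simp: chart_at_def is_chart_def chart_point_def)
  then show ?thesis by blast
qed

text \<open>The existence of a chart keeps the second conjunct from being vacuous, and the
  quantification over all charts makes the isomorphism hold in whichever chart the tangent space is
  computed.\<close>

theorem proposition6:
  fixes scale :: "'k::field \<Rightarrow> 'b::ab_group_add \<Rightarrow> 'b"
    and Q :: "('v, 'a) pre_digraph"
    and M U :: "'v \<Rightarrow> 'b set" and f :: "'a \<Rightarrow> 'b \<Rightarrow> 'b"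
    and m e :: "'v \<Rightarrow> nat"
  assumes "vector_space scale"
    and "fin_digraph Q" and "\<nexists>p. pre_digraph.cycle Q p"
    and "is_fd_rep scale Q M f" and "has_dim_vector scale Q M m"
    and "is_subrep scale Q M f U" and "has_dim_vector scale Q U e"
  shows "(\<exists>B I a. chart_at scale Q M e U B I a) \<and>
    (\<forall>B I a. chart_at scale Q M e U B I a \<longrightarrow>
       lin_iso (quiver_grass_tangent scale Q f B I a)
         (rep_hom Q (rep_of scale U f) (quot_rep Q (rep_of scale M f) U)))"
proof (intro conjI allI impI)
  show "\<exists>B I a. chart_at scale Q M e U B I a"
    using vector_space.chart_exists assms by blast
next
  fix B I a assume "chart_at scale Q M e U B I a"
  with assms interpret quiver_chart scale Q M U B I f e a
    by (simp add: quiver_chart_def quiver_chart_axioms_def fin_digraph_def)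
  show "lin_iso (quiver_grass_tangent scale Q f B I a)
         (rep_hom Q (rep_of scale U f) (quot_rep Q (rep_of scale M f) U))"
    by (rule tangent_iso_hom)
qed

end
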